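(* Let $T>0$, $x_0\in\mathbb{R}^d$, and let $g,h,f,\mathcal{B}$, the Hamiltonian $H$, the value function $u$, the running cost $L$, and the discrete value function $\bar u$ be as defined in the context. Assume: (i) $g:\mathbb{R}^d\to\mathbb{R}$ is locally semiconcave and there is a constant $k$ with $g(x)\ge -k(1+|x|)$ for all $x\in\mathbb{R}^d$. (ii) $H:\mathbb{R}^d\times\mathbb{R}^d\to\mathbb{R}$ is differentiable everywhere; $H_\lambda(\cdot,\lambda)$ is locally Lipschitz continuous for every $\lambda\in\mathbb{R}^d$; $H_x$ is continuous on $\mathbb{R}^d\times\mathbb{R}^d$; $H(x,\cdot)$ is concave for every $x\in\mathbb{R}^d$; and there exist a convex, nondecreasing function $\mu:[0,\infty)\to\mathbb{R}$ and positive constants $A$, $B$ such that $$-H(x,\lambda)\le \mu(|\lambda|)+|x|(A+B|\lambda|)\quad\text{for all }(x,\lambda)\in\mathbb{R}^d\times\mathbb{R}^d.$$ (iii) $H$ is bounded in $C^2(\mathbb{R}^d\times\mathbb{R}^d)$. For every discretization $0=t_0<t_1<\dots<t_N=T$, with $\Delta t_n:=t_{n+1}-t_n$ and $\Delta t_{\max}:=\max_n\Delta t_n$, let $\{X_n\}_{n=0}^N$, $\{\lambda_n\}_{n=0}^N$ be a discrete optimal path for $\bar u(x_0,0)$ together with a corresponding discrete dual path, as described in the context. (iv) There exists a constant $C$ such that for every discretization $\{t_n\}$ and all $n$, $$|\lambda_n-u_x(X_n,t_n)|\le C\,\Delta t_{\max}.$$ Assume further that either of the following two conditions holds: Condition 1.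 The value function $u$ is bounded in $C^3((0,T)\times\mathbb{R}^d)$. Condition 2. There exists a neighborhood in $C([0,T],\mathbb{R}^d)$ around the minimizer $X:[0,T]\to\mathbb{R}^d$ for $u(x_0,0)$ in which the value function $u$ is bounded in $C^3$. Moreover, the discrete solutions $\{X_n\}$ converge to the continuous solution $X(t)$ in the sense that $\max_n|X_n-X(t_n)|\to 0$ as $\Delta t_{\max}\to 0$. If Condition 1 holds, then there is a constant $C'$ (independent of the discretization) such that for every discretization $\{t_n\}$ $$\bar u(x_0,0)-u(x_0,0)=\sum_{n=0}^{N-1}\Delta t_n^2\,\rho_n+R,\qquad \rho_n:=-\frac{H_\lambda(X_n,\lambda_{n+1})\cdot H_x(X_n,\lambda_{n+1})}{2},$$ where the remainder satisfies $|R|\le C'\Delta t_{\max}^2$. If Condition 2 holds, then there exist a threshold time step $\Delta t_{\mathrm{thres}}>0$ and a constant $C'$ (independent of the discretization) such that for every discretization with $\Delta t_{\max}\le\Delta t_{\mathrm{thres}}$ the same representation, with the same density $\rho_n$ and with $|R|\le C'\Delta t_{\max}^2$, holds.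
   Context: Optimal control problem. $\mathcal{B}$ is a subset of a Euclidean space $\mathbb{R}^{d'}$, and $f:\mathbb{R}^d\times\mathcal{B}\to\mathbb{R}^d$, $h:\mathbb{R}^d\times\mathcal{B}\to\mathbb{R}$, $g:\mathbb{R}^d\to\mathbb{R}$ are given functions. The Hamiltonian is $$H(x,\lambda):=\min_{\alpha\in\mathcal{B}}\{\lambda\cdot f(x,\alpha)+h(x,\alpha)\},\qquad (x,\lambda)\in\mathbb{R}^d\times\mathbb{R}^d.$$ The value function is, for $(x,t)\in\mathbb{R}^d\times[0,T]$, $$u(x,t):=\inf\Big\{\int_t^T h(X(s),\alpha(s))\,ds+g(X(T))\Big\},$$ the infimum being over controls $\alpha:[t,T]\to\mathcal{B}$ and states $X:[t,T]\to\mathbb{R}^d$ with $X'(s)=f(X(s),\alpha(s))$ for $t<s\le T$ and $X(t)=x$ (controls measurable, states absolutely continuous, the ODE holding almost everywhere). "The minimizer for $u(x_0,0)$" is a state path $X$ attaining this infimum for $(x,t)=(x_0,0)$. Standing assumption: $u$ is the solution of the Hamilton-Jacobi-Bellman equation $u_t+H(x,u_x)=0$ for $x\in\mathbb{R}^d$, $0\le t<T$, with $u(\cdot,T)=g$; in particular the equation holds pointwise where $u$ is smooth. Here $u_t$ is the time derivative and $u_x$ the spatial gradient of $u$; $H_x$, $H_\lambda$ are the gradients of $H$ in its first and second variable. Running cost. $L(x,\beta):=\sup_{\lambda\in\mathbb{R}^d}\big(-\beta\cdot\lambda+H(x,\lambda)\big)\in\mathbb{R}\cup\{+\infty\}$ for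 $x,\beta\in\mathbb{R}^d$. Discrete value function. For a discretization $0=t_0<\dots<t_N=T$ with $\Delta t_n=t_{n+1}-t_n$, $$\bar u(y,t_m):=\inf\{J_{(y,t_m)}(\beta_m,\dots,\beta_{N-1}) : \beta_m,\dots,\beta_{N-1}\in\mathbb{R}^d\},$$ $$J_{(y,t_m)}(\beta_m,\dots,\beta_{N-1}):=\sum_{n=m}^{N-1}\Delta t_n L(X_n,\beta_n)+g(X_N),$$ where $X_m=y$ and $X_{n+1}=X_n+\Delta t_n\beta_n$ for $m\le n\le N-1$. Discrete optimal path and dual path. Under assumptions (i) and (ii) of the claim it is known that $J_{(x_0,0)}$ has a minimizer $(\beta_0,\dots,\beta_{N-1})$, and that, with $(X_0,\dots,X_N)$ the corresponding path ($X_0=x_0$, $X_{n+1}=X_n+\Delta t_n\beta_n$), for each $\lambda_N\in D^+g(X_N)$ there are $\lambda_0,\dots,\lambda_{N-1}$ such that the Symplectic Euler scheme $$X_{n+1}=X_n+\Delta t_nH_\lambda(X_n,\lambda_{n+1}),\qquad \lambda_n=\lambda_{n+1}+\Delta t_nH_x(X_n,\lambda_{n+1}),\qquad 0\le n\le N-1,$$ holds, and hence $\beta_n=H_\lambda(X_n,\lambda_{n+1})$. For every discretization, $\{X_n\},\{\lambda_n\}$ in the claim denote such a minimizing path and such a dual path, with $\lambda_N\in D^+g(X_N)$ (so $\lambda_N=g_x(X_N)$, the gradient of $g$, when $g$ is differentiable at $X_N$). Terminology. A function is bounded in $C^k$ if it belongs to $C^k$ and has bounded derivatives of order less than or equal to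 $k$. That $u$ is bounded in $C^3$ in a neighborhood in $C([0,T],\mathbb{R}^d)$ (sup norm) of $X$ means that $u$ is bounded in $C^3$ on a tube $\{(x,t):|x-X(t)|<\varepsilon,\ 0<t<T\}$ for some $\varepsilon>0$. A function $\phi:S\to\mathbb{R}$, $S\subset\mathbb{R}^d$, is semiconcave if there is a nondecreasing upper semicontinuous $\omega:\mathbb{R}_+\to\mathbb{R}_+$ with $\lim_{\rho\to0^+}\omega(\rho)=0$ and $$w\phi(x)+(1-w)\phi(y)-\phi(wx+(1-w)y)\le w(1-w)|x-y|\,\omega(|x-y|)$$ for all $x,y\in S$ such that the segment $[x,y]$ is contained in $S$ and all $w\in[0,1]$. It is locally semiconcave on $S$ if it is semiconcave on every compact subset of $S$. The superdifferential $D^+\phi(x)$ of $\phi:\mathbb{R}^d\to\mathbb{R}$ at $x$ is the set of $p\in\mathbb{R}^d$ with $\limsup_{y\to x}\frac{\phi(y)-\phi(x)-p\cdot(y-x)}{|y-x|}\le0$. *)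

theory Defs
  imports "HOL-Analysis.Analysis"
begin

section \<open>Gradients and bounded \<open>C\<^sup>k\<close> functions\<close>

definition grad :: "('a::euclidean_space \<Rightarrow> real) \<Rightarrow> 'a \<Rightarrow> 'a" where
  "grad \<phi> x = (THE p. GDERIV \<phi> x :> p)"

lemma grad_eqI:
  assumes "GDERIV \<phi> x :> p"
  shows "grad \<phi> x = p"
  unfolding grad_def
proof (rule the_equality)
  show "GDERIV \<phi> x :> p" by fact
next
  fix q assume "GDERIV \<phi> x :> q"
  then have "(\<lambda>v. v \<bullet> q) = (\<lambda>v. v \<bullet> p)"
    using assms has_derivative_unique unfolding gderiv_def by blast
  then show "q = p"
    by (metis euclidean_eqI inner_commute)
qed

lemma differentiable_imp_GDERIV_grad:
  fixes \<phi> :: "'a::euclidean_space \<Rightarrow> real"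
  assumes "\<phi> differentiable (at x)"
  shows "GDERIV \<phi> x :> grad \<phi> x"
proof -
  obtain D where D: "(\<phi> has_derivative D) (at x)"
    using assms by (auto simp: differentiable_def)
  then have "linear D" by (rule has_derivative_linear)
  then have "D = (\<lambda>v. v \<bullet> adjoint D 1)"
    by (simp add: fun_eq_iff adjoint_works)
  with D have "GDERIV \<phi> x :> adjoint D 1"
    by (simp add: gderiv_def)
  then show ?thesis
    using grad_eqI by metis
qed

primrec iterated_partial :: "'a::euclidean_space list \<Rightarrow> ('a \<Rightarrow> real) \<Rightarrow> 'a \<Rightarrow> real" where
  "iterated_partial [] \<phi> = \<phi>"
| "iterated_partial (b # bs) \<phi> = iterated_partial bs (\<lambda>x. frechet_derivative \<phi> (at x) b)"

text \<open>Intended for open \<open>S\<close>, since the derivatives are two-sided.\<close>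

definition Ck_on :: "nat \<Rightarrow> 'a::euclidean_space set \<Rightarrow> ('a \<Rightarrow> real) \<Rightarrow> bool" where
  "Ck_on k S \<phi> \<longleftrightarrow>
     (\<forall>bs. set bs \<subseteq> Basis \<longrightarrow>
        (length bs < k \<longrightarrow> (\<forall>x\<in>S. iterated_partial bs \<phi> differentiable (at x))) \<and>
        (length bs \<le> k \<longrightarrow> continuous_on S (iterated_partial bs \<phi>)))"

text \<open>
  The derivatives of orders \<open>1, \<dots>, k\<close> are bounded; the function itself need not be.
  (A Hamiltonian that is concave in its second argument and bounded would not depend on that
  argument at all.)
\<close>

definition bounded_in_Ck :: "nat \<Rightarrow> 'a::euclidean_space set \<Rightarrow> ('a \<Rightarrow> real) \<Rightarrow> bool" where
  "bounded_in_Ck k S \<phi> \<longleftrightarrow>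
     Ck_on k S \<phi> \<and>
     (\<forall>bs. set bs \<subseteq> Basis \<and> 1 \<le> length bs \<and> length bs \<le> k \<longrightarrow>
        bounded (iterated_partial bs \<phi> ` S))"

section \<open>Semiconcavity and superdifferentials\<close>

definition upper_semicontinuous_on :: "real set \<Rightarrow> (real \<Rightarrow> real) \<Rightarrow> bool" where
  "upper_semicontinuous_on S \<omega> \<longleftrightarrow>
     (\<forall>r\<in>S. \<forall>y>\<omega> r. eventually (\<lambda>s. \<omega> s < y) (at r within S))"

definition semiconcave_on :: "'a::euclidean_space set \<Rightarrow> ('a \<Rightarrow> real) \<Rightarrow> bool" where
  "semiconcave_on S \<phi> \<longleftrightarrow>
     (\<exists>\<omega>. (\<forall>r\<ge>0. 0 \<le> \<omega> r) \<and> mono_on {0..} \<omega> \<and> upper_semicontinuous_on {0..} \<omega> \<and>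
          (\<omega> \<longlongrightarrow> 0) (at_right 0) \<and>
          (\<forall>x\<in>S. \<forall>y\<in>S. \<forall>w\<in>{0..1}. closed_segment x y \<subseteq> S \<longrightarrow>
             w * \<phi> x + (1 - w) * \<phi> y - \<phi> (w *\<^sub>R x + (1 - w) *\<^sub>R y)
               \<le> w * (1 - w) * norm (x - y) * \<omega> (norm (x - y))))"

definition locally_semiconcave_on :: "'a::euclidean_space set \<Rightarrow> ('a \<Rightarrow> real) \<Rightarrow> bool" where
  "locally_semiconcave_on S \<phi> \<longleftrightarrow> (\<forall>K. compact K \<and> K \<subseteq> S \<longrightarrow> semiconcave_on K \<phi>)"

definition superdifferential :: "('a::euclidean_space \<Rightarrow> real) \<Rightarrow> 'a \<Rightarrow> 'a set" where
  "superdifferential \<phi> x =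
     {p. Limsup (at x) (\<lambda>y. ereal ((\<phi> y - \<phi> x - p \<bullet> (y - x)) / norm (y - x))) \<le> 0}"

section \<open>The optimal control problem\<close>

text \<open>The Hamiltonian is a minimum: it is attained for all \<open>x\<close> and \<open>l\<close>.\<close>

definition is_hamiltonian ::
  "'c::euclidean_space set \<Rightarrow> ('a::euclidean_space \<Rightarrow> 'c \<Rightarrow> 'a) \<Rightarrow> ('a \<Rightarrow> 'c \<Rightarrow> real) \<Rightarrow>
   ('a \<Rightarrow> 'a \<Rightarrow> real) \<Rightarrow> bool" where
  "is_hamiltonian \<B> f h H \<longleftrightarrow>
     (\<forall>x l. (\<exists>\<alpha>\<in>\<B>. H x l = l \<bullet> f x \<alpha> + h x \<alpha>) \<and> (\<forall>\<alpha>\<in>\<B>. H x l \<le> l \<bullet> f x \<alpha> + h x \<alpha>))"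

text \<open>The elements of a division of a subset of the line are non-overlapping closed intervals.\<close>

definition absolutely_continuous_on ::
  "real \<Rightarrow> real \<Rightarrow> (real \<Rightarrow> 'a::euclidean_space) \<Rightarrow> bool" where
  "absolutely_continuous_on a b X \<longleftrightarrow>
     (\<forall>\<epsilon>>0. \<exists>\<delta>>0. \<forall>\<D> S. \<D> division_of S \<and> S \<subseteq> {a..b} \<and> (\<Sum>K\<in>\<D>. Sup K - Inf K) < \<delta> \<longrightarrow>
        (\<Sum>K\<in>\<D>. norm (X (Sup K) - X (Inf K))) < \<epsilon>)"

text \<open>
  Integrability of the running cost makes the cost functional well defined. Since
  \<open>h x \<alpha> \<ge> H x 0\<close>, it only excludes, for continuous \<open>H\<close>, paths whose running cost is not
  measurable or integrates to \<open>+\<infinity>\<close>.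
\<close>

definition admissible ::
  "real \<Rightarrow> 'c::euclidean_space set \<Rightarrow> ('a::euclidean_space \<Rightarrow> 'c \<Rightarrow> 'a) \<Rightarrow> ('a \<Rightarrow> 'c \<Rightarrow> real) \<Rightarrow>
   'a \<Rightarrow> real \<Rightarrow> (real \<Rightarrow> 'c) \<Rightarrow> (real \<Rightarrow> 'a) \<Rightarrow> bool" where
  "admissible T \<B> f h x t \<alpha> X \<longleftrightarrow>
     \<alpha> \<in> borel_measurable (lebesgue_on {t..T}) \<and> (\<forall>s\<in>{t..T}. \<alpha> s \<in> \<B>) \<and>
     absolutely_continuous_on t T X \<and> X t = x \<and>
     (AE s in lebesgue. s \<in> {t<..T} \<longrightarrow>
        (X has_vector_derivative f (X s) (\<alpha> s)) (at s within {t..T})) \<and>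
     set_integrable lebesgue {t..T} (\<lambda>s. h (X s) (\<alpha> s))"

definition cost ::
  "real \<Rightarrow> ('a::euclidean_space \<Rightarrow> 'c::euclidean_space \<Rightarrow> real) \<Rightarrow> ('a \<Rightarrow> real) \<Rightarrow>
   real \<Rightarrow> (real \<Rightarrow> 'c) \<Rightarrow> (real \<Rightarrow> 'a) \<Rightarrow> real" where
  "cost T h g t \<alpha> X = set_lebesgue_integral lebesgue {t..T} (\<lambda>s. h (X s) (\<alpha> s)) + g (X T)"

definition value_function ::
  "real \<Rightarrow> 'c::euclidean_space set \<Rightarrow> ('a::euclidean_space \<Rightarrow> 'c \<Rightarrow> 'a) \<Rightarrow> ('a \<Rightarrow> 'c \<Rightarrow> real) \<Rightarrow>
   ('a \<Rightarrow> real) \<Rightarrow> 'a \<Rightarrow> real \<Rightarrow> ereal" where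
  "value_function T \<B> f h g x t =
     (INF (\<alpha>, X)\<in>{(\<alpha>, X). admissible T \<B> f h x t \<alpha> X}. ereal (cost T h g t \<alpha> X))"

definition is_minimizer ::
  "real \<Rightarrow> 'c::euclidean_space set \<Rightarrow> ('a::euclidean_space \<Rightarrow> 'c \<Rightarrow> 'a) \<Rightarrow> ('a \<Rightarrow> 'c \<Rightarrow> real) \<Rightarrow>
   ('a \<Rightarrow> real) \<Rightarrow> 'a \<Rightarrow> real \<Rightarrow> (real \<Rightarrow> 'a) \<Rightarrow> bool" where
  "is_minimizer T \<B> f h g x t X \<longleftrightarrow>
     (\<exists>\<alpha>. admissible T \<B> f h x t \<alpha> X \<and>
          ereal (cost T h g t \<alpha> X) = value_function T \<B> f h g x t)"

text \<open>
  Continuous viscosity solutions of \<open>u\<^sub>t + H(x,u\<^sub>x) = 0\<close>, \<open>0 \<le> t < T\<close>, \<open>u(\<cdot>,T) = g\<close>.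
  As data are prescribed at the terminal time, the inequalities are reversed in comparison with
  an initial value problem. At \<open>t = 0\<close> the test functions touch \<open>u\<close> from inside
  \<open>t \<ge> 0\<close> only.
\<close>

definition HJB_solution ::
  "real \<Rightarrow> ('a::euclidean_space \<Rightarrow> 'a \<Rightarrow> real) \<Rightarrow> ('a \<Rightarrow> real) \<Rightarrow> ('a \<Rightarrow> real \<Rightarrow> real) \<Rightarrow> bool" where
  "HJB_solution T H g u \<longleftrightarrow>
     continuous_on (UNIV \<times> {0..T}) (\<lambda>(x, t). u x t) \<and>
     (\<forall>x. u x T = g x) \<and>
     (\<forall>x t \<phi> U. 0 \<le> t \<and> t < T \<and> open U \<and> (x, t) \<in> U \<and> Ck_on 1 U (\<lambda>(y, s). \<phi> y s) \<longrightarrow>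
        ((\<forall>\<^sub>F (y, s) in at (x, t) within UNIV \<times> {0..<T}. u y s - \<phi> y s \<le> u x t - \<phi> x t) \<longrightarrow>
           deriv (\<phi> x) t + H x (grad (\<lambda>y. \<phi> y t) x) \<ge> 0) \<and>
        ((\<forall>\<^sub>F (y, s) in at (x, t) within UNIV \<times> {0..<T}. u y s - \<phi> y s \<ge> u x t - \<phi> x t) \<longrightarrow>
           deriv (\<phi> x) t + H x (grad (\<lambda>y. \<phi> y t) x) \<le> 0))"

section \<open>The discrete problem\<close>

text \<open>A discretization \<open>0 = t\<^sub>0 < \<dots> < t\<^sub>N = T\<close> is the list \<open>[t\<^sub>0, \<dots>, t\<^sub>N]\<close>.\<close>

definition discretization :: "real \<Rightarrow> real list \<Rightarrow> bool" where
  "discretization T ts \<longleftrightarrow>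
     2 \<le> length ts \<and> hd ts = 0 \<and> last ts = T \<and> sorted_wrt (<) ts"

abbreviation steps :: "real list \<Rightarrow> nat" where
  "steps ts \<equiv> length ts - 1"

definition dt :: "real list \<Rightarrow> nat \<Rightarrow> real" where
  "dt ts n = ts ! Suc n - ts ! n"

definition dt_max :: "real list \<Rightarrow> real" where
  "dt_max ts = Max (dt ts ` {..<steps ts})"

definition running_cost :: "('a::euclidean_space \<Rightarrow> 'a \<Rightarrow> real) \<Rightarrow> 'a \<Rightarrow> 'a \<Rightarrow> ereal" where
  "running_cost H x \<beta> = (SUP l. ereal (- (\<beta> \<bullet> l) + H x l))"

definition discrete_state ::
  "real list \<Rightarrow> nat \<Rightarrow> 'a::euclidean_space \<Rightarrow> (nat \<Rightarrow> 'a) \<Rightarrow> nat \<Rightarrow> 'a" where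
  "discrete_state ts m y \<beta> n = y + (\<Sum>k=m..<n. dt ts k *\<^sub>R \<beta> k)"

lemma discrete_state_start: "discrete_state ts m y \<beta> m = y"
  by (simp add: discrete_state_def)

lemma discrete_state_Suc:
  "m \<le> n \<Longrightarrow> discrete_state ts m y \<beta> (Suc n) = discrete_state ts m y \<beta> n + dt ts n *\<^sub>R \<beta> n"
  by (simp add: discrete_state_def)

text \<open>Only the entries \<open>\<beta> m, \<dots>, \<beta> (N - 1)\<close> matter.\<close>

definition discrete_cost ::
  "('a::euclidean_space \<Rightarrow> 'a \<Rightarrow> real) \<Rightarrow> ('a \<Rightarrow> real) \<Rightarrow> real list \<Rightarrow> nat \<Rightarrow> 'a \<Rightarrow>
   (nat \<Rightarrow> 'a) \<Rightarrow> ereal" where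
  "discrete_cost H g ts m y \<beta> =
     (\<Sum>n=m..<steps ts. ereal (dt ts n) * running_cost H (discrete_state ts m y \<beta> n) (\<beta> n))
     + ereal (g (discrete_state ts m y \<beta> (steps ts)))"

definition discrete_value ::
  "('a::euclidean_space \<Rightarrow> 'a \<Rightarrow> real) \<Rightarrow> ('a \<Rightarrow> real) \<Rightarrow> real list \<Rightarrow> nat \<Rightarrow> 'a \<Rightarrow> ereal" where
  "discrete_value H g ts m y = (INF \<beta>. discrete_cost H g ts m y \<beta>)"

definition discrete_optimal_path ::
  "('a::euclidean_space \<Rightarrow> 'a \<Rightarrow> real) \<Rightarrow> ('a \<Rightarrow> real) \<Rightarrow> real list \<Rightarrow> 'a \<Rightarrow> (nat \<Rightarrow> 'a) \<Rightarrow> bool" where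
  "discrete_optimal_path H g ts x\<^sub>0 X \<longleftrightarrow>
     (\<exists>\<beta>. (\<forall>\<beta>'. discrete_cost H g ts 0 x\<^sub>0 \<beta> \<le> discrete_cost H g ts 0 x\<^sub>0 \<beta>') \<and>
          (\<forall>n\<le>steps ts. X n = discrete_state ts 0 x\<^sub>0 \<beta> n))"

definition discrete_dual_path ::
  "('a::euclidean_space \<Rightarrow> 'a \<Rightarrow> real) \<Rightarrow> ('a \<Rightarrow> real) \<Rightarrow> real list \<Rightarrow> (nat \<Rightarrow> 'a) \<Rightarrow>
   (nat \<Rightarrow> 'a) \<Rightarrow> bool" where
  "discrete_dual_path H g ts X l \<longleftrightarrow>
     l (steps ts) \<in> superdifferential g (X (steps ts)) \<and>
     (\<forall>n<steps ts.
        X (Suc n) = X n + dt ts n *\<^sub>R grad (\<lambda>p. H (X n) p) (l (Suc n)) \<and>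
        l n = l (Suc n) + dt ts n *\<^sub>R grad (\<lambda>x. H x (l (Suc n))) (X n))"

definition error_density ::
  "('a::euclidean_space \<Rightarrow> 'a \<Rightarrow> real) \<Rightarrow> (nat \<Rightarrow> 'a) \<Rightarrow> (nat \<Rightarrow> 'a) \<Rightarrow> nat \<Rightarrow> real" where
  "error_density H X l n =
     - (grad (\<lambda>p. H (X n) p) (l (Suc n)) \<bullet> grad (\<lambda>x. H x (l (Suc n))) (X n)) / 2"

end

theory Submission
  imports Defs
begin

text \<open>
  Along the discrete optimal path \<open>\<beta>\<^sub>n = H\<^sub>\<lambda>(X\<^sub>n,\<lambda>\<^sub>n\<^sub>+\<^sub>1)\<close>, so by concavity
  \<open>L(X\<^sub>n,\<beta>\<^sub>n) = H(X\<^sub>n,\<lambda>\<^sub>n\<^sub>+\<^sub>1) - \<beta>\<^sub>n \<bullet> \<lambda>\<^sub>n\<^sub>+\<^sub>1\<close>, and the error is a telescoping sum of the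
  increments of \<open>u\<close> along the segments of the path plus \<open>\<Delta>t\<^sub>n L(X\<^sub>n,\<beta>\<^sub>n)\<close>. Each increment is computed
  with the trapezoidal rule. The slopes at the nodes are given by the HJB equation, and a Taylor
  expansion of \<open>H\<close> about \<open>(X\<^sub>n,\<lambda>\<^sub>n\<^sub>+\<^sub>1)\<close> leaves
  \<open>-\<Delta>t\<^sub>n\<^sup>2 H\<^sub>\<lambda> \<bullet> H\<^sub>x / 2\<close>, because the linear terms in \<open>u\<^sub>x - \<lambda>\<^sub>n\<^sub>+\<^sub>1\<close> cancel.
  The function \<open>u\<close> is smooth only for \<open>0 < t < T\<close>, so in the first and the last interval the
  slope is known at one end only; the resulting error \<open>O(\<Delta>t\<^sup>2)\<close> is harmless, as it
  occurs only twice. The discretization with a single interval is unique, and is covered by the choice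
  of the constant or of the threshold.
\<close>

section \<open>Directional derivatives of C^k functions\<close>

lemma has_derivative_partials:
  fixes \<phi> :: "'a::euclidean_space \<Rightarrow> real"
  assumes "\<phi> differentiable (at x)"
  shows "(\<phi> has_derivative (\<lambda>v. \<Sum>b\<in>Basis. (v \<bullet> b) * frechet_derivative \<phi> (at x) b)) (at x)"
proof -
  have D: "(\<phi> has_derivative frechet_derivative \<phi> (at x)) (at x)"
    using assms frechet_derivative_works by blast
  then have lin: "linear (frechet_derivative \<phi> (at x))" by (rule has_derivative_linear)
  have "frechet_derivative \<phi> (at x) v = (\<Sum>b\<in>Basis. (v \<bullet> b) * frechet_derivative \<phi> (at x) b)" for v
  proof -
    have "frechet_derivative \<phi> (at x) v = frechet_derivative \<phi> (at x) (\<Sum>b\<in>Basis. (v \<bullet> b) *\<^sub>R b)"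
      by (simp add: euclidean_representation)
    then show ?thesis by (simp add: linear_sum[OF lin] linear_cmul[OF lin])
  qed
  then have "frechet_derivative \<phi> (at x) = (\<lambda>v. \<Sum>b\<in>Basis. (v \<bullet> b) * frechet_derivative \<phi> (at x) b)"
    by blast
  with D show ?thesis by metis
qed

text \<open>This is (w . grad)^k \<phi> expanded over the words of length k in the basis. The
  recursion differentiates the argument function first, as \<open>iterated_partial\<close> does, so
  that induction on k transfers smoothness and bounds from the iterated partial derivatives.\<close>

primrec directional_derivative ::
  "nat \<Rightarrow> 'a::euclidean_space \<Rightarrow> ('a \<Rightarrow> real) \<Rightarrow> 'a \<Rightarrow> real" where
  "directional_derivative 0 w \<phi> x = \<phi> x"
| "directional_derivative (Suc k) w \<phi> x =
     (\<Sum>b\<in>Basis. (w \<bullet> b) * directional_derivative k w (\<lambda>y. frechet_derivative \<phi> (at y) b) x)"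

lemma directional_derivative_1:
  fixes \<phi> :: "'a::euclidean_space \<Rightarrow> real"
  assumes "(\<phi> has_derivative D) (at x)"
  shows "directional_derivative (Suc 0) w \<phi> x = D w"
proof -
  have "\<phi> differentiable (at x)"
    using assms by (auto simp: differentiable_def)
  from has_derivative_unique[OF has_derivative_partials[OF this] assms]
  show ?thesis by (auto dest: fun_cong[where x = w])
qed

lemma Ck_on_partial:
  assumes "Ck_on (Suc k) S \<phi>" "b \<in> Basis"
  shows "Ck_on k S (\<lambda>x. frechet_derivative \<phi> (at x) b)"
  unfolding Ck_on_def
proof (intro allI impI)
  fix bs :: "'a list" assume "set bs \<subseteq> Basis"
  with assms(2) have "set (b # bs) \<subseteq> Basis" by simp
  then show "(length bs < k \<longrightarrow> (\<forall>x\<in>S. iterated_partial bs (\<lambda>x. frechet_derivative \<phi> (at x) b) differentiable at x)) \<and>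
      (length bs \<le> k \<longrightarrow> continuous_on S (iterated_partial bs (\<lambda>x. frechet_derivative \<phi> (at x) b)))"
    using assms(1)[unfolded Ck_on_def, rule_format, of "b # bs"] by simp
qed

lemma Ck_on_differentiable:
  assumes "Ck_on (Suc k) S \<phi>" "x \<in> S"
  shows "\<phi> differentiable (at x)"
  using assms(1)[unfolded Ck_on_def, rule_format, of "[]"] assms(2) by simp

lemma Ck_on_le:
  assumes "Ck_on k S \<phi>" "j \<le> k"
  shows "Ck_on j S \<phi>"
  using assms unfolding Ck_on_def by force

text \<open>The directional derivatives are the successive derivatives of \<phi> along the line z +
  s w, which reduces estimates on segments to one-variable calculus. The induction has to generalize
  \<phi>, because the hypothesis is applied to its partial derivatives, which have one order of
  smoothness less.\<close>

lemma DERIV_directional_derivative: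
  fixes \<phi> :: "'a::euclidean_space \<Rightarrow> real"
  assumes "Ck_on (Suc k) S \<phi>" "z + s *\<^sub>R w \<in> S"
  shows "((\<lambda>s. directional_derivative k w \<phi> (z + s *\<^sub>R w)) has_real_derivative
           directional_derivative (Suc k) w \<phi> (z + s *\<^sub>R w)) (at s)"
  using assms(1)
proof (induction k arbitrary: \<phi>)
  case 0
  have d: "(\<phi> has_derivative (\<lambda>v. \<Sum>b\<in>Basis. (v \<bullet> b) * frechet_derivative \<phi> (at (z + s *\<^sub>R w)) b))
      (at (z + s *\<^sub>R w))"
    using has_derivative_partials Ck_on_differentiable 0 assms(2) by blast
  have "((\<lambda>s. z + s *\<^sub>R w) has_derivative (\<lambda>t. t *\<^sub>R w)) (at s)"
    by (auto intro!: derivative_eq_intros)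
  from has_derivative_compose[OF this d]
  have "((\<lambda>s. \<phi> (z + s *\<^sub>R w)) has_derivative
      (\<lambda>t. (\<Sum>b\<in>Basis. (w \<bullet> b) * frechet_derivative \<phi> (at (z + s *\<^sub>R w)) b) * t)) (at s)"
    by (simp add: sum_distrib_left mult_ac)
  then show ?case
    by (simp add: has_field_derivative_def)
next
  case (Suc k)
  have "((\<lambda>s. (w \<bullet> b) * directional_derivative k w (\<lambda>y. frechet_derivative \<phi> (at y) b) (z + s *\<^sub>R w))
      has_real_derivative
      (w \<bullet> b) * directional_derivative (Suc k) w (\<lambda>y. frechet_derivative \<phi> (at y) b) (z + s *\<^sub>R w)) (at s)"
    if "b \<in> Basis" for b
    by (rule DERIV_cmult) (rule Suc.IH[OF Ck_on_partial[OF Suc.prems that]])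
  then show ?case
    unfolding directional_derivative.simps(2)[of "Suc k" w \<phi>]
      directional_derivative.simps(2)[of k w \<phi>]
    by (rule DERIV_sum)
qed

text \<open>Each of the k nested sums has \<open>DIM('a)\<close> terms, with coefficients at most
  \<open>norm w\<close> in absolute value.\<close>

lemma directional_derivative_bound:
  fixes \<phi> :: "'a::euclidean_space \<Rightarrow> real"
  assumes "\<And>bs. set bs \<subseteq> Basis \<Longrightarrow> length bs = k \<Longrightarrow> \<bar>iterated_partial bs \<phi> x\<bar> \<le> K"
  shows "\<bar>directional_derivative k w \<phi> x\<bar> \<le> K * (norm w * DIM('a)) ^ k"
  using assms
proof (induction k arbitrary: \<phi>)
  case 0
  then show ?case by force
next
  case (Suc k)
  have *: "\<bar>directional_derivative k w (\<lambda>y. frechet_derivative \<phi> (at y) b) x\<bar> \<le> K * (norm w * DIM('a)) ^ k"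
    if "b \<in> Basis" for b
  proof (rule Suc.IH)
    fix bs :: "'a list" assume "set bs \<subseteq> Basis" "length bs = k"
    then show "\<bar>iterated_partial bs (\<lambda>y. frechet_derivative \<phi> (at y) b) x\<bar> \<le> K"
      using Suc.prems[of "b # bs"] that by simp
  qed
  have "\<bar>directional_derivative (Suc k) w \<phi> x\<bar> \<le> (\<Sum>b\<in>(Basis::'a set). norm w * (K * (norm w * DIM('a)) ^ k))"
    unfolding directional_derivative.simps
    by (rule order_trans[OF sum_abs], rule sum_mono)
       (auto simp: abs_mult intro!: mult_mono Basis_le_norm *)
  also have "\<dots> = K * (norm w * DIM('a)) ^ Suc k"
    by (simp add: mult_ac)
  finally show ?case .
qed

text \<open>There are finitely many basis words of length at most k, so one constant serves all
  orders. Order 0 is left out because \<open>bounded_in_Ck\<close> does not bound the function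
  itself.\<close>

lemma bounded_in_Ck_directional:
  fixes \<phi> :: "'a::euclidean_space \<Rightarrow> real"
  assumes "bounded_in_Ck k S \<phi>"
  obtains K where "K \<ge> 0"
    "\<And>j w x. 1 \<le> j \<Longrightarrow> j \<le> k \<Longrightarrow> x \<in> S \<Longrightarrow> \<bar>directional_derivative j w \<phi> x\<bar> \<le> K * norm w ^ j"
proof -
  let ?B = "{bs. set bs \<subseteq> (Basis::'a set) \<and> length bs \<le> k}"
  have fin: "finite ?B" by (rule finite_lists_length_le) simp
  have "\<exists>K. \<forall>x\<in>S. \<bar>iterated_partial bs \<phi> x\<bar> \<le> K" if "bs \<in> ?B" "1 \<le> length bs" for bs
    using assms that unfolding bounded_in_Ck_def bounded_iff by auto
  then obtain K where K: "\<And>bs x. bs \<in> ?B \<Longrightarrow> 1 \<le> length bs \<Longrightarrow> x \<in> S \<Longrightarrow> \<bar>iterated_partial bs \<phi> x\<bar> \<le> K bs"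
    by metis
  define M where "M = (\<Sum>bs\<in>?B. \<bar>K bs\<bar>)"
  have KM: "K bs \<le> M" if "bs \<in> ?B" for bs
    using member_le_sum[OF that, of "\<lambda>bs. \<bar>K bs\<bar>"] fin by (auto simp: M_def)
  have M0: "M \<ge> 0" by (simp add: M_def sum_nonneg)
  show thesis
  proof (rule that)
    show "0 \<le> M * real (DIM('a)) ^ k" using M0 by simp
    fix j w x assume j: "1 \<le> j" "j \<le> k" and x: "x \<in> S"
    have "\<bar>directional_derivative j w \<phi> x\<bar> \<le> M * (norm w * DIM('a)) ^ j"
    proof (rule directional_derivative_bound)
      fix bs :: "'a list" assume "set bs \<subseteq> Basis" "length bs = j"
      then show "\<bar>iterated_partial bs \<phi> x\<bar> \<le> M"
        using K[of bs x] KM[of bs] j x by force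
    qed
    also have "\<dots> = M * real (DIM('a)) ^ j * norm w ^ j"
      by (simp add: power_mult_distrib mult_ac)
    \<comment> \<open>Since \<open>DIM('a)\<close> is at least 1, its power of order j is at most
      the one of order k, which makes the constant independent of j.\<close>
    also have "\<dots> \<le> M * real (DIM('a)) ^ k * norm w ^ j"
      using M0 j DIM_positive[where 'a='a]
      by (intro mult_right_mono mult_left_mono power_increasing) (auto simp: Suc_le_eq)
    finally show "\<bar>directional_derivative j w \<phi> x\<bar> \<le> M * real (DIM('a)) ^ k * norm w ^ j" .
  qed
qed

section \<open>Taylor and trapezoidal estimates in one variable\<close>

lemma taylor2_error:
  fixes \<phi> \<phi>' \<phi>'' :: "real \<Rightarrow> real"
  assumes "0 \<le> h"
    and d1: "\<And>s. s \<in> {a..a+h} \<Longrightarrow> (\<phi> has_real_derivative \<phi>' s) (at s)"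
    and d2: "\<And>s. s \<in> {a..a+h} \<Longrightarrow> (\<phi>' has_real_derivative \<phi>'' s) (at s)"
    and K: "\<And>s. s \<in> {a..a+h} \<Longrightarrow> \<bar>\<phi>'' s\<bar> \<le> K"
  shows "\<bar>\<phi> (a + h) - \<phi> a - h * \<phi>' a\<bar> \<le> K * h\<^sup>2 / 2"
proof (cases "h = 0")
  case False
  with assms(1) have h: "h > 0" by simp
  define diff where "diff n = (if n = 0 then \<phi> else if n = 1 then \<phi>' else \<phi>'')" for n :: nat
  have "\<exists>t>a. t < a + h \<and> \<phi> (a + h) = (\<Sum>m<2. diff m a / fact m * ((a + h) - a) ^ m) + diff 2 t / fact 2 * ((a + h) - a) ^ 2"
    by (rule Taylor_up) (use h d1 d2 in \<open>auto simp: diff_def less_Suc_eq numeral_2_eq_2\<close>)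
  then obtain t where t: "t > a" "t < a + h" "\<phi> (a + h) = \<phi> a + h * \<phi>' a + \<phi>'' t / 2 * h\<^sup>2"
    by (auto simp: diff_def numeral_2_eq_2 mult_ac)
  have "\<bar>\<phi>'' t / 2 * h\<^sup>2\<bar> \<le> K / 2 * h\<^sup>2"
    using K[of t] t by (simp add: abs_mult mult_right_mono)
  with t show ?thesis by simp
qed simp

text \<open>Expand \<phi> with a third-order and \<phi>' with a second-order remainder; the terms
  with \<phi>''(a) cancel. The remainders add up to (1/6 + 1/4) K h^3, which is rounded up to K
  h^3.\<close>

lemma trapezoid_error:
  fixes \<phi> \<phi>' \<phi>'' \<phi>''' :: "real \<Rightarrow> real"
  assumes "0 \<le> h"
    and d1: "\<And>s. s \<in> {a..a+h} \<Longrightarrow> (\<phi> has_real_derivative \<phi>' s) (at s)"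
    and d2: "\<And>s. s \<in> {a..a+h} \<Longrightarrow> (\<phi>' has_real_derivative \<phi>'' s) (at s)"
    and d3: "\<And>s. s \<in> {a..a+h} \<Longrightarrow> (\<phi>'' has_real_derivative \<phi>''' s) (at s)"
    and K: "\<And>s. s \<in> {a..a+h} \<Longrightarrow> \<bar>\<phi>''' s\<bar> \<le> K"
  shows "\<bar>\<phi> (a + h) - \<phi> a - h / 2 * (\<phi>' a + \<phi>' (a + h))\<bar> \<le> K * h ^ 3"
proof (cases "h = 0")
  case False
  with assms(1) have h: "h > 0" by simp
  have K0: "K \<ge> 0" using K[of a] h by auto
  define diff where "diff n = (if n = 0 then \<phi> else if n = 1 then \<phi>' else if n = 2 then \<phi>'' else \<phi>''')" for n :: nat
  have "\<exists>t>a. t < a + h \<and> \<phi> (a + h) = (\<Sum>m<3. diff m a / fact m * ((a + h) - a) ^ m) + diff 3 t / fact 3 * ((a + h) - a) ^ 3"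
    by (rule Taylor_up) (use h d1 d2 d3 in \<open>auto simp: diff_def less_Suc_eq numeral_3_eq_3 numeral_2_eq_2\<close>)
  then obtain t where t: "t > a" "t < a + h"
    "\<phi> (a + h) = \<phi> a + h * \<phi>' a + \<phi>'' a / 2 * h\<^sup>2 + \<phi>''' t / 6 * h ^ 3"
    by (auto simp: diff_def numeral_3_eq_3 mult_ac fact_numeral numeral_2_eq_2)
  have e1: "\<bar>\<phi>''' t / 6 * h ^ 3\<bar> \<le> K / 6 * h ^ 3"
    using K[of t] t h by (simp add: abs_mult mult_right_mono)
  have "\<bar>\<phi>' (a + h) - \<phi>' a - h * \<phi>'' a\<bar> \<le> K * h\<^sup>2 / 2"
    using assms by (intro taylor2_error[where \<phi>'' = \<phi>''']) auto
  then have "h / 2 * \<bar>\<phi>' (a + h) - \<phi>' a - h * \<phi>'' a\<bar> \<le> h / 2 * (K * h\<^sup>2 / 2)"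
    using h by (intro mult_left_mono) auto
  then have e2: "\<bar>h / 2 * (\<phi>' (a + h) - \<phi>' a - h * \<phi>'' a)\<bar> \<le> K * h ^ 3 / 4"
    using h by (simp add: abs_mult power2_eq_square power3_eq_cube mult_ac)
  have "\<phi> (a + h) - \<phi> a - h / 2 * (\<phi>' a + \<phi>' (a + h)) =
      \<phi>''' t / 6 * h ^ 3 - h / 2 * (\<phi>' (a + h) - \<phi>' a - h * \<phi>'' a)"
    unfolding t(3) by (simp add: field_simps power2_eq_square)
  also have "\<bar>\<dots>\<bar> \<le> K / 6 * h ^ 3 + K * h ^ 3 / 4"
    using e1 e2 by linarith
  also have "\<dots> \<le> K * h ^ 3"
    using K0 h by (simp add: field_simps)
  finally show ?thesis .
qed simp

section \<open>Partial gradients and the expansion of the Hamiltonian\<close>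

lemma GDERIV_partials:
  fixes F :: "'a::euclidean_space \<Rightarrow> 'b::euclidean_space \<Rightarrow> real"
  assumes D: "((\<lambda>(x, y). F x y) has_derivative D) (at (x, y))"
  shows "D (v, w) = grad (\<lambda>x. F x y) x \<bullet> v + grad (\<lambda>y. F x y) y \<bullet> w"
proof -
  have lin: "linear D" using D by (rule has_derivative_linear)
  have 1: "((\<lambda>x. F x y) has_derivative (\<lambda>v. D (v, 0))) (at x)"
  proof -
    have "((\<lambda>x. (x, y)) has_derivative (\<lambda>v. (v, 0))) (at x)"
      by (auto intro!: derivative_eq_intros)
    from has_derivative_compose[OF this D] show ?thesis by simp
  qed
  have 2: "((\<lambda>y. F x y) has_derivative (\<lambda>w. D (0, w))) (at y)"
  proof -
    have "((\<lambda>y. (x, y)) has_derivative (\<lambda>w. (0, w))) (at y)"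
      by (auto intro!: derivative_eq_intros)
    from has_derivative_compose[OF this D] show ?thesis by simp
  qed
  have "GDERIV (\<lambda>x. F x y) x :> grad (\<lambda>x. F x y) x"
    using 1 by (intro differentiable_imp_GDERIV_grad) (auto simp: differentiable_def)
  then have a: "(\<lambda>v. v \<bullet> grad (\<lambda>x. F x y) x) = (\<lambda>v. D (v, 0))"
    unfolding gderiv_def using 1 has_derivative_unique by blast
  have "GDERIV (\<lambda>y. F x y) y :> grad (\<lambda>y. F x y) y"
    using 2 by (intro differentiable_imp_GDERIV_grad) (auto simp: differentiable_def)
  then have b: "(\<lambda>w. w \<bullet> grad (\<lambda>y. F x y) y) = (\<lambda>w. D (0, w))"
    unfolding gderiv_def using 2 has_derivative_unique by blast
  have "D (v, w) = D (v, 0) + D (0, w)"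
    using linear_add[OF lin, of "(v, 0)" "(0, w)"] by simp
  then show ?thesis
    using fun_cong[OF a, of v] fun_cong[OF b, of w] by (simp add: inner_commute)
qed

lemma directional_derivative_1_Pair:
  fixes F :: "'a::euclidean_space \<Rightarrow> 'b::euclidean_space \<Rightarrow> real"
  assumes "(\<lambda>(x, y). F x y) differentiable (at (x, y))"
  shows "directional_derivative (Suc 0) (v, w) (\<lambda>(x, y). F x y) (x, y) =
    grad (\<lambda>x. F x y) x \<bullet> v + grad (\<lambda>y. F x y) y \<bullet> w"
  using assms GDERIV_partials directional_derivative_1 unfolding differentiable_def by metis

text \<open>The derivative in the direction of the partial gradient p itself is |p|^2, and the
  assumed bound makes this at most K |p|.\<close>

lemma norm_grad_le:
  fixes F :: "'a::euclidean_space \<Rightarrow> 'b::euclidean_space \<Rightarrow> real"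
  assumes "(\<lambda>(x, y). F x y) differentiable (at (x, y))"
    and "\<And>w. \<bar>directional_derivative (Suc 0) w (\<lambda>(x, y). F x y) (x, y)\<bar> \<le> K * norm w"
  shows "norm (grad (\<lambda>x. F x y) x) \<le> K" "norm (grad (\<lambda>y. F x y) y) \<le> K"
proof -
  have *: "norm p \<le> K" if "p \<bullet> p \<le> K * norm p" for p :: "'z::euclidean_space"
  proof (cases "p = 0")
    case True
    \<comment> \<open>For p = 0 the claim is 0 \<le> K, which follows from the bound in some unit
      direction.\<close>
    have "norm (SOME b::'a. b \<in> Basis) = 1" by simp
    then have "0 \<le> K"
      using assms(2)[of "(SOME b. b \<in> Basis, 0)"] by (simp add: norm_Pair)
    with True show ?thesis by simp
  next
    case False
    with that show ?thesis
      by (simp add: dot_square_norm power2_eq_square)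
  qed
  show "norm (grad (\<lambda>x. F x y) x) \<le> K"
    using assms(2)[of "(grad (\<lambda>x. F x y) x, 0)"]
    by (intro *) (simp add: directional_derivative_1_Pair[OF assms(1)] norm_Pair del: directional_derivative.simps)
  show "norm (grad (\<lambda>y. F x y) y) \<le> K"
    using assms(2)[of "(0, grad (\<lambda>y. F x y) y)"]
    by (intro *) (simp add: directional_derivative_1_Pair[OF assms(1)] norm_Pair del: directional_derivative.simps)
qed

text \<open>Taylor's formula on the segment from (x,l) to (x+y,l+m), parametrized by the unit
  interval. The bound on the directional derivatives of orders 1 and 2 controls both the gradients
  and the remainder, so a single K suffices.\<close>

lemma bounded_in_C2_taylor:
  fixes H :: "'a::euclidean_space \<Rightarrow> 'b::euclidean_space \<Rightarrow> real"
  assumes "bounded_in_Ck 2 UNIV (\<lambda>(x, l). H x l)"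
  obtains K where "K \<ge> 0"
    "\<And>x l. norm (grad (\<lambda>x. H x l) x) \<le> K"
    "\<And>x l. norm (grad (\<lambda>l. H x l) l) \<le> K"
    "\<And>x l y m. \<bar>H (x + y) (l + m) - H x l - (grad (\<lambda>x. H x l) x \<bullet> y + grad (\<lambda>l. H x l) l \<bullet> m)\<bar>
       \<le> K * ((norm y)\<^sup>2 + (norm m)\<^sup>2)"
proof -
  let ?H = "\<lambda>(x, l). H x l"
  obtain K where K0: "K \<ge> 0" and K: "\<And>j w x. 1 \<le> j \<Longrightarrow> j \<le> 2 \<Longrightarrow> \<bar>directional_derivative j w ?H x\<bar> \<le> K * norm w ^ j"
    using bounded_in_Ck_directional[OF assms] by auto
  have C: "Ck_on (Suc (Suc 0)) UNIV ?H"
    using assms by (simp add: bounded_in_Ck_def numeral_2_eq_2)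
  have C1: "Ck_on (Suc 0) UNIV ?H" by (rule Ck_on_le[OF C]) simp
  have diff: "?H differentiable (at z)" for z
    using Ck_on_differentiable[OF C] by simp
  show thesis
  proof (rule that[OF K0])
    fix x l
    have *: "\<bar>directional_derivative (Suc 0) w ?H (x, l)\<bar> \<le> K * norm w" for w
      using K[of "Suc 0" w "(x, l)"] by simp
    show "norm (grad (\<lambda>x. H x l) x) \<le> K" "norm (grad (\<lambda>l. H x l) l) \<le> K"
      by (rule norm_grad_le[OF diff *])+
    fix y m
    let ?d = "\<lambda>j s. directional_derivative j (y, m) ?H ((x, l) + s *\<^sub>R (y, m))"
    have "\<bar>?d 0 (0 + 1) - ?d 0 0 - 1 * ?d (Suc 0) 0\<bar> \<le> (K * norm (y, m) ^ 2) * 1\<^sup>2 / 2"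
    proof (rule taylor2_error)
      fix s :: real
      show "(?d 0 has_real_derivative ?d (Suc 0) s) (at s)"
        by (rule DERIV_directional_derivative[OF C1]) simp
      show "(?d (Suc 0) has_real_derivative ?d (Suc (Suc 0)) s) (at s)"
        by (rule DERIV_directional_derivative[OF C]) simp
      show "\<bar>?d (Suc (Suc 0)) s\<bar> \<le> K * norm (y, m) ^ 2"
        using K[of "Suc (Suc 0)"] by (simp add: numeral_2_eq_2 del: directional_derivative.simps)
    qed simp
    then have "\<bar>H (x + y) (l + m) - H x l - (grad (\<lambda>x. H x l) x \<bullet> y + grad (\<lambda>l. H x l) l \<bullet> m)\<bar> \<le> K * norm (y, m) ^ 2 / 2"
      by (simp add: directional_derivative_1_Pair[OF diff] del: directional_derivative.simps(2))
    also have "\<dots> \<le> K * ((norm y)\<^sup>2 + (norm m)\<^sup>2)"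
      using K0 by (simp add: norm_Pair)
    finally show "\<bar>H (x + y) (l + m) - H x l - (grad (\<lambda>x. H x l) x \<bullet> y + grad (\<lambda>l. H x l) l \<bullet> m)\<bar> \<le> K * ((norm y)\<^sup>2 + (norm m)\<^sup>2)" .
  qed
qed

section \<open>The HJB equation where the value function is smooth\<close>

lemma grad_eq_deriv:
  fixes \<psi> :: "real \<Rightarrow> real"
  assumes "\<psi> differentiable (at t)"
  shows "grad \<psi> t = deriv \<psi> t"
proof -
  have "(\<psi> has_real_derivative grad \<psi> t) (at t)"
    using differentiable_imp_GDERIV_grad[OF assms]
    by (simp add: gderiv_def has_field_derivative_def mult_commute_abs)
  then show ?thesis by (simp add: DERIV_imp_deriv)
qed

text \<open>Where u is C^1 it may serve as its own test function: u - u is constant, so u touches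
  itself from both sides, and the two viscosity inequalities combine to an equality.\<close>

lemma HJB_pointwise:
  assumes "HJB_solution T H g u" "open S" "Ck_on 1 S (\<lambda>(x, t). u x t)" "(x, t) \<in> S" "0 \<le> t" "t < T"
  shows "deriv (u x) t + H x (grad (\<lambda>y. u y t) x) = 0"
proof -
  have "(deriv (u x) t + H x (grad (\<lambda>y. u y t) x) \<ge> 0) \<and> (deriv (u x) t + H x (grad (\<lambda>y. u y t) x) \<le> 0)"
    using assms(1)[unfolded HJB_solution_def, THEN conjunct2, THEN conjunct2, rule_format, of t S x u]
      assms(2-) by (simp add: case_prod_unfold)
  then show ?thesis by simp
qed

text \<open>The slope of u along a path with velocity v is u_t + v . u_x, and the equation replaces
  u_t by -H.\<close>

lemma HJB_directional:
  assumes "HJB_solution T H g u" "open S" "Ck_on 1 S (\<lambda>(x, t). u x t)" "(x, t) \<in> S" "0 \<le> t" "t < T"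
  shows "directional_derivative (Suc 0) (v, 1) (\<lambda>(x, t). u x t) (x, t) =
    v \<bullet> grad (\<lambda>y. u y t) x - H x (grad (\<lambda>y. u y t) x)"
proof -
  have d: "(\<lambda>(x, t). u x t) differentiable (at (x, t))"
    using Ck_on_differentiable assms(3,4) by (metis One_nat_def)
  have "(\<lambda>t. u x t) differentiable (at t)"
  proof -
    have "(\<lambda>(x, t). u x t) \<circ> (\<lambda>t. (x, t)) differentiable (at t)"
      by (rule differentiable_chain_at) (use d in auto)
    then show ?thesis by (simp add: o_def)
  qed
  then have "grad (\<lambda>t. u x t) t = deriv (u x) t" by (rule grad_eq_deriv)
  then show ?thesis
    using HJB_pointwise[OF assms] directional_derivative_1_Pair[OF d, of v 1]
    by (simp add: inner_commute del: directional_derivative.simps)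
qed

section \<open>Running cost and value along the discrete optimal path\<close>

text \<open>A differentiable concave function lies below its tangent at l. Hence for \<beta> =
  H_\<lambda>(x,l) the supremum defining the running cost is attained at l, and is finite.\<close>

lemma running_cost_eq:
  fixes H :: "'a::euclidean_space \<Rightarrow> 'a \<Rightarrow> real"
  assumes conc: "concave_on UNIV (H x)" and d: "H x differentiable (at l)"
  shows "running_cost H x (grad (H x) l) = ereal (- (grad (H x) l \<bullet> l) + H x l)"
proof -
  let ?\<beta> = "grad (H x) l"
  have G: "(H x has_derivative (\<lambda>v. v \<bullet> ?\<beta>)) (at l)"
    using differentiable_imp_GDERIV_grad[OF d] by (simp add: gderiv_def)
  have tangent: "H x m \<le> H x l + ?\<beta> \<bullet> (m - l)" for m
  proof -
    have aff: "((\<lambda>s. l + s *\<^sub>R (m - l)) has_derivative (\<lambda>s. s *\<^sub>R (m - l))) (at 0)"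
      by (auto intro!: derivative_eq_intros)
    have "((\<lambda>s. H x (l + s *\<^sub>R (m - l))) has_derivative (\<lambda>s. (s *\<^sub>R (m - l)) \<bullet> ?\<beta>)) (at 0)"
      by (rule has_derivative_compose[OF aff]) (use G in simp)
    then have D: "((\<lambda>s. H x (l + s *\<^sub>R (m - l))) has_real_derivative ?\<beta> \<bullet> (m - l)) (at 0)"
      by (simp add: has_field_derivative_def inner_commute mult_commute_abs)
    have lim: "((\<lambda>s. (H x (l + s *\<^sub>R (m - l)) - H x l) / s) \<longlongrightarrow> ?\<beta> \<bullet> (m - l)) (at_right 0)"
      using D by (simp add: has_field_derivative_iff filterlim_at_split)
    \<comment> \<open>By concavity the chord slope over [0,1] bounds the difference quotients with 0
      < s < 1 from below. The limit at 0 from the right turns this into the tangent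
      inequality.\<close>
    have ev: "\<forall>\<^sub>F s in at_right 0. H x m - H x l \<le> (H x (l + s *\<^sub>R (m - l)) - H x l) / s"
      unfolding eventually_at_right_field
    proof (intro exI[of _ 1] conjI allI impI)
      fix s :: real assume s: "0 < s" "s < 1"
      have "(1 - s) * H x l + s * H x m \<le> H x ((1 - s) *\<^sub>R l + s *\<^sub>R m)"
        using conc s unfolding concave_on_iff by (auto elim!: allE[of _ "1 - s"] allE[of _ s])
      also have "(1 - s) *\<^sub>R l + s *\<^sub>R m = l + s *\<^sub>R (m - l)" by (simp add: algebra_simps)
      finally show "H x m - H x l \<le> (H x (l + s *\<^sub>R (m - l)) - H x l) / s"
        using s by (simp add: field_simps)
    qed simp
    have "H x m - H x l \<le> ?\<beta> \<bullet> (m - l)"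
      by (rule tendsto_lowerbound[OF lim ev]) simp
    then show ?thesis by simp
  qed
  show ?thesis
    unfolding running_cost_def
  proof (rule antisym)
    show "(SUP m. ereal (- (?\<beta> \<bullet> m) + H x m)) \<le> ereal (- (?\<beta> \<bullet> l) + H x l)"
      by (rule SUP_least) (use tangent in \<open>auto simp: inner_diff_right algebra_simps\<close>)
    show "ereal (- (?\<beta> \<bullet> l) + H x l) \<le> (SUP m. ereal (- (?\<beta> \<bullet> m) + H x m))"
      by (rule SUP_upper) simp
  qed
qed

lemma discretization_nth:
  assumes "discretization T ts"
  shows "ts ! 0 = 0" "ts ! steps ts = T" "n < steps ts \<Longrightarrow> 0 < dt ts n"
    "n < steps ts \<Longrightarrow> dt ts n \<le> dt_max ts"
    "n \<le> steps ts \<Longrightarrow> ts ! n \<in> {0..T}" "0 < n \<Longrightarrow> n < steps ts \<Longrightarrow> ts ! n \<in> {0<..<T}"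
    "(\<Sum>n<steps ts. dt ts n) = T" "dt_max ts \<le> T"
proof -
  have ne: "ts \<noteq> []" and len: "2 \<le> length ts" and s: "sorted_wrt (<) ts"
    using assms by (auto simp: discretization_def)
  show t0: "ts ! 0 = 0" using assms ne by (simp add: discretization_def hd_conv_nth)
  show tN: "ts ! steps ts = T" using assms ne by (simp add: discretization_def last_conv_nth)
  have lt: "ts ! i < ts ! j" if "i < j" "j \<le> steps ts" for i j
    using sorted_wrt_nth_less[OF s, of i j] that len by auto
  show pos: "0 < dt ts n" if "n < steps ts" for n
    using lt[of n "Suc n"] that by (simp add: dt_def)
  show le: "dt ts n \<le> dt_max ts" if "n < steps ts" for n
    using that by (auto simp: dt_max_def)
  show in_cl: "ts ! n \<in> {0..T}" if "n \<le> steps ts" for n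
    using lt[of 0 n] lt[of n "steps ts"] t0 tN that
    by (cases "n = 0"; cases "n = steps ts") auto
  show "ts ! n \<in> {0<..<T}" if "0 < n" "n < steps ts"
    using lt[of 0 n] lt[of n "steps ts"] t0 tN that by auto
  show "(\<Sum>n<steps ts. dt ts n) = T"
    unfolding dt_def sum_lessThan_telescope using t0 tN by simp
  have "0 < steps ts" using len by simp
  have "dt ts n \<le> T" if "n < steps ts" for n
    using in_cl[of n] in_cl[of "Suc n"] that by (auto simp: dt_def)
  then show "dt_max ts \<le> T"
    unfolding dt_max_def using \<open>0 < steps ts\<close> by (subst Max_le_iff) (auto simp: lessThan_empty_iff)
qed

text \<open>The dual path identifies the optimal controls as H_\<lambda>(X_n,\<lambda>_(n+1)),
  exactly where \<open>running_cost_eq\<close> evaluates the running cost. So the value, defined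
  with extended reals, becomes a real sum.\<close>

lemma discrete_value_eq:
  fixes H :: "'a::euclidean_space \<Rightarrow> 'a \<Rightarrow> real"
  assumes disc: "discretization T ts"
    and conc: "\<And>x. concave_on UNIV (H x)" and d: "\<And>x l. H x differentiable (at l)"
    and opt: "discrete_optimal_path H g ts x\<^sub>0 X" and dual: "discrete_dual_path H g ts X l"
  shows "X 0 = x\<^sub>0"
    and "discrete_value H g ts 0 x\<^sub>0 = ereal ((\<Sum>n<steps ts. dt ts n *
      (H (X n) (l (Suc n)) - grad (H (X n)) (l (Suc n)) \<bullet> l (Suc n))) + g (X (steps ts)))"
proof -
  obtain \<beta> where opt: "\<And>\<beta>'. discrete_cost H g ts 0 x\<^sub>0 \<beta> \<le> discrete_cost H g ts 0 x\<^sub>0 \<beta>'"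
    and X: "\<And>n. n \<le> steps ts \<Longrightarrow> X n = discrete_state ts 0 x\<^sub>0 \<beta> n"
    using opt unfolding discrete_optimal_path_def by blast
  show "X 0 = x\<^sub>0" using X[of 0] by (simp add: discrete_state_start)
  have \<beta>: "\<beta> n = grad (H (X n)) (l (Suc n))" if n: "n < steps ts" for n
  proof -
    \<comment> \<open>The state recursion and the symplectic scheme describe the same increment of
      the path; as the time step is positive, it cancels.\<close>
    have "dt ts n *\<^sub>R \<beta> n = dt ts n *\<^sub>R grad (H (X n)) (l (Suc n))"
      using dual n X[of n] X[of "Suc n"] discrete_state_Suc[of 0 n ts x\<^sub>0 \<beta>]
      unfolding discrete_dual_path_def by auto
    then show ?thesis using discretization_nth(3)[OF disc n] by simp
  qed
  have "discrete_value H g ts 0 x\<^sub>0 = discrete_cost H g ts 0 x\<^sub>0 \<beta>"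
    unfolding discrete_value_def by (rule antisym) (auto intro: INF_lower INF_greatest opt)
  also have "\<dots> = (\<Sum>n<steps ts. ereal (dt ts n * (H (X n) (l (Suc n)) - grad (H (X n)) (l (Suc n)) \<bullet> l (Suc n))))
      + ereal (g (X (steps ts)))"
  proof -
    have "ereal (dt ts n) * running_cost H (discrete_state ts 0 x\<^sub>0 \<beta> n) (\<beta> n) =
        ereal (dt ts n * (H (X n) (l (Suc n)) - grad (H (X n)) (l (Suc n)) \<bullet> l (Suc n)))"
      if n: "n < steps ts" for n
    proof -
      have "discrete_state ts 0 x\<^sub>0 \<beta> n = X n" using X[of n] n by simp
      then show ?thesis by (simp add: \<beta>[OF n] running_cost_eq[of H "X n" "l (Suc n)", OF conc d])
    qed
    then show ?thesis
      unfolding discrete_cost_def atLeast0LessThan using X[of "steps ts"]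
      by (metis (no_types, lifting) lessThan_iff order_refl sum.cong)
  qed
  finally show "discrete_value H g ts 0 x\<^sub>0 = ereal ((\<Sum>n<steps ts. dt ts n *
      (H (X n) (l (Suc n)) - grad (H (X n)) (l (Suc n)) \<bullet> l (Suc n))) + g (X (steps ts)))"
    by simp
qed

section \<open>The local error of one time step\<close>

text \<open>
  By the HJB equation, the derivative of \<open>u\<close> along the segment with velocity
  \<open>\<beta> = H\<^sub>\<lambda>(x,a)\<close> is minus the running cost, up to terms of first order in the
  increments, of which only the one with \<open>H\<^sub>x\<close> survives.
\<close>

lemma slope_error:
  fixes H :: "'a::euclidean_space \<Rightarrow> 'a \<Rightarrow> real"
  assumes HJB: "HJB_solution T H g u" "open S" "Ck_on 1 S (\<lambda>(x, t). u x t)"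
    and S: "(x + s *\<^sub>R grad (H x) a, t) \<in> S" "0 \<le> t" "t < T"
    and taylor: "\<And>y m. \<bar>H (x + y) (a + m) - H x a - (grad (\<lambda>x. H x a) x \<bullet> y + grad (H x) a \<bullet> m)\<bar>
       \<le> K * ((norm y)\<^sup>2 + (norm m)\<^sup>2)"
    and bounds: "0 \<le> K" "0 \<le> s" "norm (grad (H x) a) \<le> K"
      "norm (grad (\<lambda>y. u y t) (x + s *\<^sub>R grad (H x) a) - a) \<le> E"
  shows "\<bar>directional_derivative (Suc 0) (grad (H x) a, 1) (\<lambda>(x, t). u x t) (x + s *\<^sub>R grad (H x) a, t)
     + (H x a - grad (H x) a \<bullet> a) + s * (grad (H x) a \<bullet> grad (\<lambda>x. H x a) x)\<bar> \<le> K * ((s * K)\<^sup>2 + E\<^sup>2)"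
proof -
  define \<beta> where "\<beta> = grad (H x) a"
  define q where "q = grad (\<lambda>y. u y t) (x + s *\<^sub>R \<beta>)"
  have "directional_derivative (Suc 0) (\<beta>, 1) (\<lambda>(x, t). u x t) (x + s *\<^sub>R \<beta>, t) = \<beta> \<bullet> q - H (x + s *\<^sub>R \<beta>) q"
    using HJB_directional[OF HJB] S unfolding q_def \<beta>_def by simp
  moreover have "\<bar>H (x + s *\<^sub>R \<beta>) q - H x a - (s * (\<beta> \<bullet> grad (\<lambda>x. H x a) x) + \<beta> \<bullet> (q - a))\<bar>
      \<le> K * ((norm (s *\<^sub>R \<beta>))\<^sup>2 + (norm (q - a))\<^sup>2)"
    using taylor[of "s *\<^sub>R \<beta>" "q - a"] by (simp add: \<beta>_def inner_commute)
  moreover have "K * ((norm (s *\<^sub>R \<beta>))\<^sup>2 + (norm (q - a))\<^sup>2) \<le> K * ((s * K)\<^sup>2 + E\<^sup>2)"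
    using bounds by (intro mult_left_mono add_mono power_mono) (auto simp: \<beta>_def q_def mult_left_mono)
  ultimately show ?thesis
    unfolding \<beta>_def[symmetric] by (simp add: inner_diff_right algebra_simps)
qed

text \<open>Here L stands for the running cost and r for H_\<lambda> . H_x. Slopes close to -L - s r
  at s = 0 and s = h have the mean -L - h r / 2, so the increment of \<phi> is close to -h L - h^2 r
  / 2. The term \<open>0 * r\<close> keeps both slope conditions in the form supplied by
  \<open>slope_error\<close>.\<close>

lemma trapezoid_slopes:
  fixes \<phi> \<phi>' \<phi>'' \<phi>''' :: "real \<Rightarrow> real"
  assumes "0 \<le> h"
    and "\<And>s. s \<in> {0..h} \<Longrightarrow> (\<phi> has_real_derivative \<phi>' s) (at s)"
    and "\<And>s. s \<in> {0..h} \<Longrightarrow> (\<phi>' has_real_derivative \<phi>'' s) (at s)"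
    and "\<And>s. s \<in> {0..h} \<Longrightarrow> (\<phi>'' has_real_derivative \<phi>''' s) (at s)"
    and "\<And>s. s \<in> {0..h} \<Longrightarrow> \<bar>\<phi>''' s\<bar> \<le> K"
    and c: "\<bar>\<phi>' 0 + L + 0 * r\<bar> \<le> c" "\<bar>\<phi>' h + L + h * r\<bar> \<le> c"
  shows "\<bar>\<phi> h - \<phi> 0 + h * L + h\<^sup>2 * r / 2\<bar> \<le> K * h ^ 3 + h * c"
proof -
  have "\<bar>\<phi> (0 + h) - \<phi> 0 - h / 2 * (\<phi>' 0 + \<phi>' (0 + h))\<bar> \<le> K * h ^ 3"
    using assms by (intro trapezoid_error) auto
  moreover have "\<bar>h / 2 * ((\<phi>' 0 + L) + (\<phi>' h + L + h * r))\<bar> \<le> h / 2 * (c + c)"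
    unfolding abs_mult using assms(1) c by (intro mult_mono) auto
  moreover have "\<phi> h - \<phi> 0 + h * L + h\<^sup>2 * r / 2 =
      (\<phi> (0 + h) - \<phi> 0 - h / 2 * (\<phi>' 0 + \<phi>' (0 + h))) + h / 2 * ((\<phi>' 0 + L) + (\<phi>' h + L + h * r))"
    by (simp add: field_simps power2_eq_square)
  moreover have "h / 2 * (c + c) = h * c" by simp
  ultimately show ?thesis by linarith
qed

lemma one_slope:
  fixes \<phi> \<phi>' \<phi>'' :: "real \<Rightarrow> real"
  assumes h: "0 < h" and cont: "continuous_on {0..h} \<phi>"
    and I: "convex I" "{0<..<h} \<subseteq> I" "I \<subseteq> {0..h}" "s\<^sub>0 \<in> I"
    and d1: "\<And>s. s \<in> I \<Longrightarrow> (\<phi> has_real_derivative \<phi>' s) (at s)"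
    and d2: "\<And>s. s \<in> I \<Longrightarrow> (\<phi>' has_real_derivative \<phi>'' s) (at s)"
    and K: "\<And>s. s \<in> I \<Longrightarrow> \<bar>\<phi>'' s\<bar> \<le> K"
    and c: "\<bar>\<phi>' s\<^sub>0 + L + s\<^sub>0 * r\<bar> \<le> c"
  shows "\<bar>\<phi> h - \<phi> 0 + h * L + h\<^sup>2 * r / 2\<bar> \<le> (K + \<bar>r\<bar>) * h\<^sup>2 + h * c"
proof -
  obtain \<xi> where \<xi>: "0 < \<xi>" "\<xi> < h" "\<phi> h - \<phi> 0 = h * \<phi>' \<xi>"
  proof -
    have "\<phi> differentiable (at s)" if "0 < s" "s < h" for s
      using d1[of s] I(2) that by (force simp: real_differentiable_def)
    from MVT[OF h cont this] obtain l \<xi> where \<xi>: "0 < \<xi>" "\<xi> < h"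
      "(\<phi> has_real_derivative l) (at \<xi>)" "\<phi> h - \<phi> 0 = (h - 0) * l"
      by blast
    moreover have "l = \<phi>' \<xi>"
      by (rule DERIV_unique[OF \<xi>(3) d1]) (use \<xi> I(2) in auto)
    ultimately show ?thesis using that by simp
  qed
  have \<xi>I: "\<xi> \<in> I" using \<xi> I(2) by auto
  have s0: "0 \<le> s\<^sub>0" "s\<^sub>0 \<le> h" using I(3,4) by auto
  have K0: "K \<ge> 0" using K[OF I(4)] by linarith
  \<comment> \<open>Convexity of I turns the bound on \<phi>'' into a Lipschitz bound for
    \<phi>'.\<close>
  have "norm (\<phi>' \<xi> - \<phi>' s\<^sub>0) \<le> K * norm (\<xi> - s\<^sub>0)"
    using I(1) by (rule field_differentiable_bound)
      (use I(4) \<xi>I K d2 in \<open>auto intro: has_field_derivative_at_within\<close>)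
  also have "\<dots> \<le> K * h" using s0 \<xi> K0 by (intro mult_left_mono) auto
  finally have 1: "\<bar>\<phi>' \<xi> - \<phi>' s\<^sub>0\<bar> \<le> K * h" by simp
  have "\<bar>h / 2 - s\<^sub>0\<bar> * \<bar>r\<bar> \<le> h * \<bar>r\<bar>"
    using s0 by (intro mult_right_mono) auto
  then have 2: "\<bar>(h / 2 - s\<^sub>0) * r\<bar> \<le> h * \<bar>r\<bar>" by (simp add: abs_mult)
  have "\<phi> h - \<phi> 0 + h * L + h\<^sup>2 * r / 2 =
      h * ((\<phi>' \<xi> - \<phi>' s\<^sub>0) + (\<phi>' s\<^sub>0 + L + s\<^sub>0 * r) + (h / 2 - s\<^sub>0) * r)"
    unfolding \<xi>(3) by (simp add: field_simps power2_eq_square)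
  also have "\<bar>\<dots>\<bar> \<le> h * (K * h + c + h * \<bar>r\<bar>)"
    unfolding abs_mult[of h] using h 1 2 c by (intro mult_mono) auto
  also have "\<dots> = (K + \<bar>r\<bar>) * h\<^sup>2 + h * c" by (simp add: algebra_simps power2_eq_square)
  finally show ?thesis .
qed

text \<open>To be read with x = X_n and a = \<lambda>_(n+1), so that a + h H_x is \<lambda>_n. The
  error is of order D^2 h if the closed time step lies in (0,T). The \<open>of_bool\<close> terms
  allow an error of order D^2 in the first and the last step. A step from 0 to T is excluded, since
  then neither end has a known slope.\<close>

lemma local_error:
  fixes H :: "'a::euclidean_space \<Rightarrow> 'a \<Rightarrow> real" and u :: "'a \<Rightarrow> real \<Rightarrow> real"
  assumes HJB: "HJB_solution T H g u" and S: "open S"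
    and C3: "bounded_in_Ck 3 S (\<lambda>(x, t). u x t)" and C2: "bounded_in_Ck 2 UNIV (\<lambda>(x, l). H x l)"
  shows "\<exists>c\<ge>0. \<forall>x a t h D. 0 < h \<and> h \<le> D \<and> D \<le> T \<and> 0 \<le> t \<and> t + h \<le> T \<and> \<not> (t = 0 \<and> t + h = T) \<and>
      (\<forall>s\<in>{0..h}. 0 < t + s \<and> t + s < T \<longrightarrow> (x + s *\<^sub>R grad (H x) a, t + s) \<in> S) \<and>
      norm (a + h *\<^sub>R grad (\<lambda>x. H x a) x - grad (\<lambda>y. u y t) x) \<le> C * D \<and>
      norm (a - grad (\<lambda>y. u y (t + h)) (x + h *\<^sub>R grad (H x) a)) \<le> C * D \<longrightarrow>
      \<bar>u (x + h *\<^sub>R grad (H x) a) (t + h) - u x t + h * (H x a - grad (H x) a \<bullet> a)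
         + h\<^sup>2 * (grad (H x) a \<bullet> grad (\<lambda>x. H x a) x) / 2\<bar>
      \<le> c * D\<^sup>2 * (h + of_bool (t = 0) + of_bool (t + h = T))"
proof -
  let ?u = "\<lambda>(x, t). u x t"
  obtain K where K0: "K \<ge> 0"
    and Kx: "\<And>x l. norm (grad (\<lambda>x. H x l) x) \<le> K"
    and Kl: "\<And>x l. norm (grad (\<lambda>l. H x l) l) \<le> K"
    and taylor: "\<And>x l y m. \<bar>H (x + y) (l + m) - H x l - (grad (\<lambda>x. H x l) x \<bullet> y + grad (\<lambda>l. H x l) l \<bullet> m)\<bar>
       \<le> K * ((norm y)\<^sup>2 + (norm m)\<^sup>2)"
    using bounded_in_C2_taylor[OF C2] by blast
  obtain M where M0: "M \<ge> 0" and M: "\<And>j w z. 1 \<le> j \<Longrightarrow> j \<le> 3 \<Longrightarrow> z \<in> S \<Longrightarrow>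
      \<bar>directional_derivative j w ?u z\<bar> \<le> M * norm w ^ j"
    using bounded_in_Ck_directional[OF C3] by blast
  have Ck3: "Ck_on 3 S ?u" using C3 by (simp add: bounded_in_Ck_def)
  \<comment> \<open>\<open>c\<^sub>1\<close> belongs to the errors of the slopes;
    \<open>c\<^sub>2\<close> bounds the second derivative of u along the segment plus |r|, as
    required by \<open>one_slope\<close>; \<open>c\<^sub>3\<close> bounds the third derivative for
    the trapezoidal rule. The power base K + 1 bounds the norm of the space-time direction (\<beta>,
    1).\<close>
  define c\<^sub>1 where "c\<^sub>1 = K * (K\<^sup>2 + (C + K)\<^sup>2)"
  define c\<^sub>2 where "c\<^sub>2 = M * (K + 1) ^ 2 + K\<^sup>2"
  define c\<^sub>3 where "c\<^sub>3 = M * (K + 1) ^ 3"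
  have c0: "c\<^sub>1 \<ge> 0" "c\<^sub>2 \<ge> 0" "c\<^sub>3 \<ge> 0" using K0 M0 by (simp_all add: c\<^sub>1_def c\<^sub>2_def c\<^sub>3_def)
  define c where "c = c\<^sub>1 + c\<^sub>2 + c\<^sub>3"
  show ?thesis
  proof (intro exI[of _ c] conjI allI impI; (elim conjE)?)
    show "0 \<le> c" using c0 by (simp add: c_def)
    fix x a :: 'a and t h D :: real
    assume h: "0 < h" "h \<le> D" and D: "D \<le> T" and t: "0 \<le> t" "t + h \<le> T" "\<not> (t = 0 \<and> t + h = T)"
      and seg: "\<forall>s\<in>{0..h}. 0 < t + s \<and> t + s < T \<longrightarrow> (x + s *\<^sub>R grad (H x) a, t + s) \<in> S"
      and n0: "norm (a + h *\<^sub>R grad (\<lambda>x. H x a) x - grad (\<lambda>y. u y t) x) \<le> C * D"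
      and n1: "norm (a - grad (\<lambda>y. u y (t + h)) (x + h *\<^sub>R grad (H x) a)) \<le> C * D"
    define \<beta> where "\<beta> = grad (H x) a"
    define r where "r = grad (H x) a \<bullet> grad (\<lambda>x. H x a) x"
    define L where "L = H x a - grad (H x) a \<bullet> a"
    define \<phi> where "\<phi> j s = directional_derivative j (\<beta>, 1) ?u ((x, t) + s *\<^sub>R (\<beta>, 1))" for j s
    have \<phi>0: "\<phi> 0 s = u (x + s *\<^sub>R \<beta>) (t + s)" for s by (simp add: \<phi>_def)
    have \<beta>K: "norm \<beta> \<le> K" using Kl by (simp add: \<beta>_def)
    have r: "\<bar>r\<bar> \<le> K\<^sup>2"
    proof -
      have "\<bar>r\<bar> \<le> norm \<beta> * norm (grad (\<lambda>x. H x a) x)"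
        unfolding r_def \<beta>_def by (rule Cauchy_Schwarz_ineq2)
      also have "\<dots> \<le> K * K" using \<beta>K Kx K0 by (intro mult_mono) auto
      finally show ?thesis by (simp add: power2_eq_square)
    qed
    have w: "norm (\<beta>, 1::real) \<le> K + 1"
      using norm_Pair_le[of \<beta> "1::real"] \<beta>K by simp
    have seg': "(x, t) + s *\<^sub>R (\<beta>, 1) \<in> S" if "s \<in> {0..h}" "0 < t + s" "t + s < T" for s
      using seg that by (simp add: \<beta>_def)
    have D\<phi>: "(\<phi> j has_real_derivative \<phi> (Suc j) s) (at s)"
      if "j < 3" "s \<in> {0..h}" "0 < t + s" "t + s < T" for j s
      unfolding \<phi>_def using that seg'
      by (intro DERIV_directional_derivative[where S = S] Ck_on_le[OF Ck3]) auto
    have B\<phi>: "\<bar>\<phi> j s\<bar> \<le> M * (K + 1) ^ j"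
      if "1 \<le> j" "j \<le> 3" "s \<in> {0..h}" "0 < t + s" "t + s < T" for j s
    proof -
      have "\<bar>\<phi> j s\<bar> \<le> M * norm (\<beta>, 1::real) ^ j"
        unfolding \<phi>_def using that seg' by (intro M) auto
      also have "\<dots> \<le> M * (K + 1) ^ j"
        using M0 w by (intro mult_left_mono power_mono) auto
      finally show ?thesis .
    qed
    \<comment> \<open>The Taylor expansions at both ends have the same base point a =
      \<lambda>_(n+1). At the left end the hypothesis concerns \<lambda>_n instead, which differs
      from a by h H_x, of norm at most K D.\<close>
    have CK: "norm (grad (\<lambda>y. u y (t + s)) (x + s *\<^sub>R \<beta>) - a) \<le> (C + K) * D" if "s = 0 \<or> s = h" for s
      using that
    proof
      assume s: "s = 0"
      have "norm (h *\<^sub>R grad (\<lambda>x. H x a) x) \<le> D * K"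
        using h Kx by (simp add: mult_mono)
      then have "norm (h *\<^sub>R grad (\<lambda>x. H x a) x - (a + h *\<^sub>R grad (\<lambda>x. H x a) x - grad (\<lambda>y. u y t) x)) \<le> D * K + C * D"
        using n0 norm_triangle_ineq4 by (smt (verit))
      then show ?thesis by (simp add: s algebra_simps)
    next
      assume s: "s = h"
      have "0 \<le> K * D" using K0 h by simp
      with n1 show ?thesis by (simp add: s \<beta>_def norm_minus_commute algebra_simps)
    qed
    have slope: "\<bar>\<phi> (Suc 0) s + L + s * r\<bar> \<le> c\<^sub>1 * D\<^sup>2" if "s = 0 \<or> s = h" "0 < t + s" "t + s < T" for s
    proof -
      have s: "s \<in> {0..h}" using that h by auto
      have "\<bar>\<phi> (Suc 0) s + L + s * r\<bar> \<le> K * ((s * K)\<^sup>2 + ((C + K) * D)\<^sup>2)"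
      proof -
        have "\<bar>directional_derivative (Suc 0) (grad (H x) a, 1) (\<lambda>(x, t). u x t) (x + s *\<^sub>R grad (H x) a, t + s)
          + (H x a - grad (H x) a \<bullet> a) + s * (grad (H x) a \<bullet> grad (\<lambda>x. H x a) x)\<bar> \<le> K * ((s * K)\<^sup>2 + ((C + K) * D)\<^sup>2)"
          by (rule slope_error[OF HJB S Ck_on_le[OF Ck3]])
            (use that s seg taylor K0 Kl CK[OF that(1)] in \<open>auto simp: \<beta>_def\<close>)
        then show ?thesis
          by (simp add: \<phi>_def \<beta>_def L_def r_def del: directional_derivative.simps)
      qed
      also have "\<dots> \<le> K * ((D * K)\<^sup>2 + ((C + K) * D)\<^sup>2)"
        using s h K0 by (intro mult_left_mono add_right_mono power_mono mult_right_mono) auto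
      also have "\<dots> = c\<^sub>1 * D\<^sup>2" by (simp only: c\<^sub>1_def power_mult_distrib) (simp add: algebra_simps)
      finally show ?thesis .
    qed
    have hc: "h * (c\<^sub>1 * D\<^sup>2) = c\<^sub>1 * D\<^sup>2 * h" by simp
    have cD: "c * D\<^sup>2 * h = c\<^sub>1 * D\<^sup>2 * h + c\<^sub>2 * D\<^sup>2 * h + c\<^sub>3 * D\<^sup>2 * h" "c * D\<^sup>2 = c\<^sub>1 * D\<^sup>2 + c\<^sub>2 * D\<^sup>2 + c\<^sub>3 * D\<^sup>2"
      by (simp_all add: c_def algebra_simps)
    have nn: "c\<^sub>1 * D\<^sup>2 * h \<ge> 0" "c\<^sub>2 * D\<^sup>2 * h \<ge> 0" "c\<^sub>3 * D\<^sup>2 * h \<ge> 0" "c\<^sub>1 * D\<^sup>2 \<ge> 0" "c\<^sub>2 * D\<^sup>2 \<ge> 0" "c\<^sub>3 * D\<^sup>2 \<ge> 0"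
      using c0 h by simp_all
    have "\<bar>\<phi> 0 h - \<phi> 0 0 + h * L + h\<^sup>2 * r / 2\<bar> \<le> c * D\<^sup>2 * (h + of_bool (t = 0) + of_bool (t + h = T))"
    proof (cases "0 < t \<and> t + h < T")
      case True
      have "\<bar>\<phi> 0 h - \<phi> 0 0 + h * L + h\<^sup>2 * r / 2\<bar> \<le> M * (K + 1) ^ 3 * h ^ 3 + h * (c\<^sub>1 * D\<^sup>2)"
      proof (rule trapezoid_slopes)
        fix s assume s: "s \<in> {0..h}"
        with True have *: "0 < t + s" "t + s < T" by auto
        show "(\<phi> 0 has_real_derivative \<phi> (Suc 0) s) (at s)"
          "(\<phi> (Suc 0) has_real_derivative \<phi> (Suc (Suc 0)) s) (at s)"
          "(\<phi> (Suc (Suc 0)) has_real_derivative \<phi> 3 s) (at s)"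
          using D\<phi>[of 0 s] D\<phi>[of "Suc 0" s] D\<phi>[of "Suc (Suc 0)" s] s * by (simp_all add: numeral_3_eq_3)
        show "\<bar>\<phi> 3 s\<bar> \<le> M * (K + 1) ^ 3" using B\<phi>[of 3 s] s * by simp
      qed (use True h slope[of 0] slope[of h] in auto)
      also have "\<dots> \<le> c * D\<^sup>2 * h"
      proof -
        have "c\<^sub>3 * h ^ 3 \<le> c\<^sub>3 * (D\<^sup>2 * h)"
          using c0 h by (intro mult_left_mono) (auto simp: power3_eq_cube power2_eq_square mult_mono)
        then show ?thesis
          unfolding c\<^sub>3_def[symmetric] cD(1) hc using nn(2) by linarith
      qed
      finally show ?thesis using True by simp
    next
      case False
      \<comment> \<open>Exactly one end of the step lies in the open interval (0,T): the right one
        if t = 0, the left one if t + h = T.\<close>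
      then obtain s\<^sub>0 where s0: "s\<^sub>0 = 0 \<or> s\<^sub>0 = h" "0 < t + s\<^sub>0" "t + s\<^sub>0 < T"
        using t h that[of 0] that[of h] by force
      let ?I = "{0..h} \<inter> {- t<..<T - t}"
      have "\<bar>\<phi> 0 h - \<phi> 0 0 + h * L + h\<^sup>2 * r / 2\<bar> \<le> (M * (K + 1) ^ 2 + \<bar>r\<bar>) * h\<^sup>2 + h * (c\<^sub>1 * D\<^sup>2)"
      proof (rule one_slope)
        \<comment> \<open>Smoothness of u stops short of the times 0 and T; continuity there is part
          of the definition of a solution of the HJB equation.\<close>
        have cont: "continuous_on (UNIV \<times> {0..T}) ?u" using HJB by (simp add: HJB_solution_def)
        have "continuous_on {0..h} (\<lambda>s. ?u (x + s *\<^sub>R \<beta>, t + s))"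
          by (rule continuous_on_compose2[OF cont]) (use t in \<open>auto intro!: continuous_intros\<close>)
        then show "continuous_on {0..h} (\<phi> 0)" by (simp add: \<phi>0[abs_def])
        show "convex ?I" by (intro convex_Int) auto
        show "s\<^sub>0 \<in> ?I" using s0 h by auto
        fix s assume "s \<in> ?I"
        then have s: "s \<in> {0..h}" "0 < t + s" "t + s < T" by auto
        show "(\<phi> 0 has_real_derivative \<phi> (Suc 0) s) (at s)"
          "(\<phi> (Suc 0) has_real_derivative \<phi> 2 s) (at s)"
          using D\<phi>[of 0 s] D\<phi>[of "Suc 0" s] s by (simp_all add: numeral_2_eq_2)
        show "\<bar>\<phi> 2 s\<bar> \<le> M * (K + 1) ^ 2" using B\<phi>[of 2 s] s by simp
      qed (use h t slope[OF s0] in auto)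
      also have "\<dots> \<le> c\<^sub>2 * D\<^sup>2 + h * (c\<^sub>1 * D\<^sup>2)"
        unfolding c\<^sub>2_def using r M0 K0 h by (intro add_right_mono mult_mono power_mono) auto
      also have "\<dots> \<le> c * D\<^sup>2 * h + c * D\<^sup>2"
        using cD nn hc by linarith
      also have "\<dots> \<le> c * D\<^sup>2 * h + c * D\<^sup>2 * (of_bool (t = 0) + of_bool (t + h = T))"
        using False t h nn by (auto simp: cD)
      finally show ?thesis by (simp add: algebra_simps)
    qed
    then show "\<bar>u (x + h *\<^sub>R grad (H x) a) (t + h) - u x t + h * (H x a - grad (H x) a \<bullet> a)
         + h\<^sup>2 * (grad (H x) a \<bullet> grad (\<lambda>x. H x a) x) / 2\<bar>
      \<le> c * D\<^sup>2 * (h + of_bool (t = 0) + of_bool (t + h = T))"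
      unfolding \<phi>0 by (simp add: \<beta>_def L_def r_def)
  qed
qed

section \<open>Summation of the local errors\<close>

text \<open>The increments of u telescope to g(X_N) - u(X_0,0), because u(.,T) = g. Having at least
  two steps ensures that no step is both the first and the last, as \<open>local_error\<close>
  demands.\<close>

lemma discrete_value_error:
  fixes H :: "'a::euclidean_space \<Rightarrow> 'a \<Rightarrow> real" and u :: "'a \<Rightarrow> real \<Rightarrow> real"
  assumes HJB: "HJB_solution T H g u" and T: "T > 0" and S: "open S"
    and C3: "bounded_in_Ck 3 S (\<lambda>(x, t). u x t)" and C2: "bounded_in_Ck 2 UNIV (\<lambda>(x, l). H x l)"
  shows "\<exists>K. \<forall>ts X l. discretization T ts \<and> 2 \<le> steps ts \<and> discrete_dual_path H g ts X l \<and>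
      (\<forall>n\<le>steps ts. norm (l n - grad (\<lambda>x. u x (ts ! n)) (X n)) \<le> C * dt_max ts) \<and>
      (\<forall>n<steps ts. \<forall>s\<in>{0..dt ts n}. 0 < ts ! n + s \<and> ts ! n + s < T \<longrightarrow>
         (X n + s *\<^sub>R grad (H (X n)) (l (Suc n)), ts ! n + s) \<in> S) \<longrightarrow>
      \<bar>(\<Sum>n<steps ts. dt ts n * (H (X n) (l (Suc n)) - grad (H (X n)) (l (Suc n)) \<bullet> l (Suc n)))
         + g (X (steps ts)) - u (X 0) 0 - (\<Sum>n<steps ts. (dt ts n)\<^sup>2 * error_density H X l n)\<bar>
      \<le> K * (dt_max ts)\<^sup>2"
proof -
  obtain c where c0: "c \<ge> 0" and c: "\<And>x a t h D. 0 < h \<Longrightarrow> h \<le> D \<Longrightarrow> D \<le> T \<Longrightarrow> 0 \<le> t \<Longrightarrow> t + h \<le> T \<Longrightarrow>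
      \<not> (t = 0 \<and> t + h = T) \<Longrightarrow>
      (\<And>s. s \<in> {0..h} \<Longrightarrow> 0 < t + s \<Longrightarrow> t + s < T \<Longrightarrow> (x + s *\<^sub>R grad (H x) a, t + s) \<in> S) \<Longrightarrow>
      norm (a + h *\<^sub>R grad (\<lambda>x. H x a) x - grad (\<lambda>y. u y t) x) \<le> C * D \<Longrightarrow>
      norm (a - grad (\<lambda>y. u y (t + h)) (x + h *\<^sub>R grad (H x) a)) \<le> C * D \<Longrightarrow>
      \<bar>u (x + h *\<^sub>R grad (H x) a) (t + h) - u x t + h * (H x a - grad (H x) a \<bullet> a)
         + h\<^sup>2 * (grad (H x) a \<bullet> grad (\<lambda>x. H x a) x) / 2\<bar>
      \<le> c * D\<^sup>2 * (h + of_bool (t = 0) + of_bool (t + h = T))"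
    using local_error[OF HJB S C3 C2, of C] by auto
  show ?thesis
  proof (intro exI[of _ "c * (T + 2)"] allI impI; elim conjE)
    fix ts :: "real list" and X l :: "nat \<Rightarrow> 'a"
    assume disc: "discretization T ts" and N2: "2 \<le> steps ts"
      and dual: "discrete_dual_path H g ts X l"
      and lC: "\<forall>n\<le>steps ts. norm (l n - grad (\<lambda>x. u x (ts ! n)) (X n)) \<le> C * dt_max ts"
      and seg: "\<forall>n<steps ts. \<forall>s\<in>{0..dt ts n}. 0 < ts ! n + s \<and> ts ! n + s < T \<longrightarrow>
         (X n + s *\<^sub>R grad (H (X n)) (l (Suc n)), ts ! n + s) \<in> S"
    let ?N = "steps ts" and ?D = "dt_max ts"
    define L where "L n = H (X n) (l (Suc n)) - grad (H (X n)) (l (Suc n)) \<bullet> l (Suc n)" for n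
    \<comment> \<open>The local error of step n: the density is -r/2, so subtracting its term
      produces the + h^2 r / 2 of \<open>local_error\<close>.\<close>
    define e where "e n = dt ts n * L n + (u (X (Suc n)) (ts ! Suc n) - u (X n) (ts ! n))
      - (dt ts n)\<^sup>2 * error_density H X l n" for n
    note D = discretization_nth[OF disc]
    have first: "ts ! n = 0 \<longleftrightarrow> n = 0" if "n < ?N" for n
      using D(1) D(6)[of n] that by (cases "n = 0") auto
    have last: "ts ! Suc n = T \<longleftrightarrow> n = ?N - 1" if "n < ?N" for n
      using D(2) D(6)[of "Suc n"] that by (cases "Suc n = ?N") auto
    have e: "\<bar>e n\<bar> \<le> c * ?D\<^sup>2 * (dt ts n + of_bool (n = 0) + of_bool (n = ?N - 1))" if n: "n < ?N" for n
    proof -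
      let ?\<beta> = "grad (H (X n)) (l (Suc n))"
      have tS: "ts ! n + dt ts n = ts ! Suc n" by (simp add: dt_def)
      have XS: "X n + dt ts n *\<^sub>R ?\<beta> = X (Suc n)"
        and lS: "l (Suc n) + dt ts n *\<^sub>R grad (\<lambda>x. H x (l (Suc n))) (X n) = l n"
        using dual n unfolding discrete_dual_path_def by auto
      have "\<bar>u (X n + dt ts n *\<^sub>R ?\<beta>) (ts ! n + dt ts n) - u (X n) (ts ! n) + dt ts n * (H (X n) (l (Suc n)) - ?\<beta> \<bullet> l (Suc n))
         + (dt ts n)\<^sup>2 * (?\<beta> \<bullet> grad (\<lambda>x. H x (l (Suc n))) (X n)) / 2\<bar>
        \<le> c * ?D\<^sup>2 * (dt ts n + of_bool (ts ! n = 0) + of_bool (ts ! n + dt ts n = T))"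
      proof (rule c)
        show "\<not> (ts ! n = 0 \<and> ts ! n + dt ts n = T)"
          using first[OF n] last[OF n] N2 by (auto simp: tS)
        show "norm (l (Suc n) + dt ts n *\<^sub>R grad (\<lambda>x. H x (l (Suc n))) (X n) - grad (\<lambda>y. u y (ts ! n)) (X n)) \<le> C * ?D"
          unfolding lS using lC n by simp
        show "norm (l (Suc n) - grad (\<lambda>y. u y (ts ! n + dt ts n)) (X n + dt ts n *\<^sub>R ?\<beta>)) \<le> C * ?D"
          unfolding XS tS using lC n by simp
      qed (use D(3,4)[of n] D(5)[of n] D(5)[of "Suc n"] D(8) n seg in \<open>auto simp: tS\<close>)
      then show ?thesis
        unfolding XS tS by (simp add: e_def L_def error_density_def first[OF n] last[OF n] add_ac)
    qed
    have "u (X ?N) T = g (X ?N)" using HJB by (simp add: HJB_solution_def)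
    moreover have "(\<Sum>n<?N. u (X (Suc n)) (ts ! Suc n) - u (X n) (ts ! n)) = u (X ?N) T - u (X 0) 0"
      using D(1,2) sum_lessThan_telescope[of "\<lambda>n. u (X n) (ts ! n)" ?N] by simp
    ultimately have "(\<Sum>n<?N. dt ts n * L n) + g (X ?N) - u (X 0) 0 - (\<Sum>n<?N. (dt ts n)\<^sup>2 * error_density H X l n)
        = (\<Sum>n<?N. e n)"
      by (simp add: e_def sum.distrib sum_subtractf)
    also have "\<bar>\<dots>\<bar> \<le> (\<Sum>n<?N. c * ?D\<^sup>2 * (dt ts n + of_bool (n = 0) + of_bool (n = ?N - 1)))"
      by (rule order_trans[OF sum_abs], rule sum_mono) (use e in auto)
    also have "\<dots> = c * ?D\<^sup>2 * ((\<Sum>n<?N. dt ts n) + (\<Sum>n<?N. of_bool (n = 0)) + (\<Sum>n<?N. of_bool (n = ?N - 1)))"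
      by (simp only: sum_distrib_left sum.distrib distrib_left)
    \<comment> \<open>The step lengths add up to T, and the first and the last step contribute 1
      each.\<close>
    also have "\<dots> = c * (T + 2) * ?D\<^sup>2"
    proof -
      have "(\<Sum>n<?N. of_bool (n = m)) = (1 :: real)" if "m < ?N" for m
        using that by (simp add: of_bool_def)
      from this[of 0] this[of "?N - 1"] show ?thesis using N2 by (simp only: D(7)) simp
    qed
    finally show "\<bar>(\<Sum>n<?N. dt ts n * (H (X n) (l (Suc n)) - grad (H (X n)) (l (Suc n)) \<bullet> l (Suc n)))
         + g (X ?N) - u (X 0) 0 - (\<Sum>n<?N. (dt ts n)\<^sup>2 * error_density H X l n)\<bar> \<le> c * (T + 2) * ?D\<^sup>2"
      by (simp add: L_def)
  qed
qed

section \<open>Tubes around the minimizer and one-step discretizations\<close>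

text \<open>Absolute continuity is applied to the division consisting of the single interval between
  the two points.\<close>

lemma absolutely_continuous_on_imp_uniformly:
  assumes "absolutely_continuous_on a b X"
  shows "uniformly_continuous_on {a..b} X"
  unfolding uniformly_continuous_on_def
proof (intro allI impI)
  fix \<epsilon> :: real assume "\<epsilon> > 0"
  then obtain \<delta> where \<delta>: "\<delta> > 0" "\<And>\<D> S. \<D> division_of S \<Longrightarrow> S \<subseteq> {a..b} \<Longrightarrow>
      (\<Sum>K\<in>\<D>. Sup K - Inf K) < \<delta> \<Longrightarrow> (\<Sum>K\<in>\<D>. norm (X (Sup K) - X (Inf K))) < \<epsilon>"
    using assms unfolding absolutely_continuous_on_def by meson
  have *: "norm (X t - X s) < \<epsilon>" if "s \<le> t" "s \<in> {a..b}" "t \<in> {a..b}" "t - s < \<delta>" for s t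
  proof -
    have "{{s..t}} division_of {s..t}"
      using division_of_self[of s t] that(1) by simp
    from \<delta>(2)[OF this] that show ?thesis by simp
  qed
  show "\<exists>d>0. \<forall>x\<in>{a..b}. \<forall>x'\<in>{a..b}. dist x' x < d \<longrightarrow> dist (X x') (X x) < \<epsilon>"
  proof (intro exI[of _ \<delta>] conjI ballI impI \<delta>(1))
    fix s t assume "s \<in> {a..b}" "t \<in> {a..b}" "dist t s < \<delta>"
    then show "dist (X t) (X s) < \<epsilon>"
      using *[of s t] *[of t s] by (cases "s \<le> t") (auto simp: dist_norm norm_minus_commute)
  qed
qed

text \<open>Provides the open set on which the local estimates are applied under Condition 2. As the
  times are restricted to the open interval, the tube is a preimage under a continuous function on
  an open set.\<close>

lemma open_tube:
  fixes X :: "real \<Rightarrow> 'a::euclidean_space"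
  assumes "continuous_on {0..T} X"
  shows "open {(x, t). 0 < t \<and> t < T \<and> norm (x - X t) < \<epsilon>}"
proof -
  let ?U = "UNIV \<times> {0<..<T} :: ('a \<times> real) set"
  have "continuous_on ?U (\<lambda>z. norm (fst z - X (snd z)))"
    by (intro continuous_intros continuous_on_compose2[OF assms]) auto
  then have "open (?U \<inter> (\<lambda>z. norm (fst z - X (snd z))) -` {..<\<epsilon>})"
    by (intro continuous_open_preimage open_Times) auto
  also have "?U \<inter> (\<lambda>z. norm (fst z - X (snd z))) -` {..<\<epsilon>} = {(x, t). 0 < t \<and> t < T \<and> norm (x - X t) < \<epsilon>}"
    by auto
  finally show ?thesis .
qed

lemma discretization_one_step:
  assumes "discretization T ts" "\<not> 2 \<le> steps ts"
  shows "ts = [0, T]" "dt_max ts = T"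
proof -
  have "length ts = Suc (Suc 0)" using assms by (auto simp: discretization_def)
  then obtain a b where "ts = [a, b]" by (auto simp: length_Suc_conv)
  with assms show ts: "ts = [0, T]" by (simp add: discretization_def)
  have "{..<steps ts} = {0}" by (auto simp: ts)
  then show "dt_max ts = T" by (simp add: dt_max_def dt_def ts)
qed

section \<open>The error representation under the two conditions\<close>

theorem theorem2p4:
  fixes T :: real and x\<^sub>0 :: "'a::euclidean_space"
    and \<B> :: "'c::euclidean_space set"
    and f :: "'a \<Rightarrow> 'c \<Rightarrow> 'a" and h :: "'a \<Rightarrow> 'c \<Rightarrow> real" and g :: "'a \<Rightarrow> real"
    and H :: "'a \<Rightarrow> 'a \<Rightarrow> real" and u :: "'a \<Rightarrow> real \<Rightarrow> real"
    and X\<^sub>d l\<^sub>d :: "real list \<Rightarrow> nat \<Rightarrow> 'a"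
  assumes T_pos: "T > 0"
    and hamiltonian: "is_hamiltonian \<B> f h H"
    and value_fn: "\<And>x t. t \<in> {0..T} \<Longrightarrow> ereal (u x t) = value_function T \<B> f h g x t"
    and HJB: "HJB_solution T H g u"
    and i_semiconcave: "locally_semiconcave_on UNIV g"
    and i_lower_bound: "\<exists>k. \<forall>x. g x \<ge> - k * (1 + norm x)"
    and ii_differentiable: "\<And>z. (\<lambda>(x, l). H x l) differentiable (at z)"
    and ii_lipschitz: "\<And>l. local_lipschitz {l} UNIV (\<lambda>l x. grad (\<lambda>p. H x p) l)"
    and ii_continuous: "continuous_on UNIV (\<lambda>(x, l). grad (\<lambda>y. H y l) x)"
    and ii_concave: "\<And>x. concave_on UNIV (\<lambda>l. H x l)"
    and ii_growth: "\<exists>(\<mu> :: real \<Rightarrow> real) A B. convex_on {0..} \<mu> \<and> mono_on {0..} \<mu> \<and> A > 0 \<and> B > 0 \<and>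
          (\<forall>x l. - H x l \<le> \<mu> (norm l) + norm x * (A + B * norm l))"
    and iii_bounded: "bounded_in_Ck 2 UNIV (\<lambda>(x, l). H x l)"
    and optimal: "\<And>ts. discretization T ts \<Longrightarrow> discrete_optimal_path H g ts x\<^sub>0 (X\<^sub>d ts)"
    and dual: "\<And>ts. discretization T ts \<Longrightarrow> discrete_dual_path H g ts (X\<^sub>d ts) (l\<^sub>d ts)"
    and iv: "\<exists>C. \<forall>ts. discretization T ts \<longrightarrow> (\<forall>n\<le>steps ts.
          (\<lambda>x. u x (ts ! n)) differentiable (at (X\<^sub>d ts n)) \<and>
          norm (l\<^sub>d ts n - grad (\<lambda>x. u x (ts ! n)) (X\<^sub>d ts n)) \<le> C * dt_max ts)"
  shows "(bounded_in_Ck 3 (UNIV \<times> {0<..<T}) (\<lambda>(x, t). u x t) \<longrightarrow>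
            (\<exists>C'. \<forall>ts. discretization T ts \<longrightarrow>
               (\<exists>R. discrete_value H g ts 0 x\<^sub>0 - ereal (u x\<^sub>0 0) =
                      ereal ((\<Sum>n<steps ts. (dt ts n)\<^sup>2 * error_density H (X\<^sub>d ts) (l\<^sub>d ts) n) + R) \<and>
                    \<bar>R\<bar> \<le> C' * (dt_max ts)\<^sup>2)))
       \<and> ((\<exists>X. is_minimizer T \<B> f h g x\<^sub>0 0 X \<and>
               (\<exists>\<epsilon>>0. bounded_in_Ck 3 {(x, t). 0 < t \<and> t < T \<and> norm (x - X t) < \<epsilon>} (\<lambda>(x, t). u x t)) \<and>
               (\<forall>e>0. \<exists>\<delta>>0. \<forall>ts. discretization T ts \<and> dt_max ts < \<delta> \<longrightarrow>
                  (MAX n\<in>{..steps ts}. norm (X\<^sub>d ts n - X (ts ! n))) < e)) \<longrightarrow>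
            (\<exists>dt_thres>0. \<exists>C'. \<forall>ts. discretization T ts \<and> dt_max ts \<le> dt_thres \<longrightarrow>
               (\<exists>R. discrete_value H g ts 0 x\<^sub>0 - ereal (u x\<^sub>0 0) =
                      ereal ((\<Sum>n<steps ts. (dt ts n)\<^sup>2 * error_density H (X\<^sub>d ts) (l\<^sub>d ts) n) + R) \<and>
                    \<bar>R\<bar> \<le> C' * (dt_max ts)\<^sup>2)))"
proof -
  have Hd: "H x differentiable (at l)" for x l
  proof -
    have "(\<lambda>(x, l). H x l) \<circ> (\<lambda>l. (x, l)) differentiable (at l)"
      by (rule differentiable_chain_at) (use ii_differentiable in auto)
    then show ?thesis by (simp add: o_def)
  qed
  \<comment> \<open>E is the remainder R. With it the representation holds for every discretization,
    and under either condition only a bound on E remains to be shown.\<close>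
  define E where "E ts = (\<Sum>n<steps ts. dt ts n *
      (H (X\<^sub>d ts n) (l\<^sub>d ts (Suc n)) - grad (H (X\<^sub>d ts n)) (l\<^sub>d ts (Suc n)) \<bullet> l\<^sub>d ts (Suc n)))
    + g (X\<^sub>d ts (steps ts)) - u x\<^sub>0 0 - (\<Sum>n<steps ts. (dt ts n)\<^sup>2 * error_density H (X\<^sub>d ts) (l\<^sub>d ts) n)" for ts
  have representation: "discrete_value H g ts 0 x\<^sub>0 - ereal (u x\<^sub>0 0) =
      ereal ((\<Sum>n<steps ts. (dt ts n)\<^sup>2 * error_density H (X\<^sub>d ts) (l\<^sub>d ts) n) + E ts)"
    if "discretization T ts" for ts
    unfolding discrete_value_eq(2)[OF that ii_concave Hd optimal[OF that] dual[OF that]] E_def by simp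
  have start: "X\<^sub>d ts 0 = x\<^sub>0" if "discretization T ts" for ts
    by (rule discrete_value_eq(1)[OF that ii_concave Hd optimal[OF that] dual[OF that]])
  obtain C where C: "\<And>ts n. discretization T ts \<Longrightarrow> n \<le> steps ts \<Longrightarrow>
      norm (l\<^sub>d ts n - grad (\<lambda>x. u x (ts ! n)) (X\<^sub>d ts n)) \<le> C * dt_max ts"
    using iv by blast
  \<comment> \<open>S will be the whole strip under Condition 1 and the tube around the minimizer
    under Condition 2.\<close>
  have error: "\<exists>K. \<forall>ts. discretization T ts \<and> 2 \<le> steps ts \<and>
      (\<forall>n<steps ts. \<forall>s\<in>{0..dt ts n}. 0 < ts ! n + s \<and> ts ! n + s < T \<longrightarrow>
         (X\<^sub>d ts n + s *\<^sub>R grad (H (X\<^sub>d ts n)) (l\<^sub>d ts (Suc n)), ts ! n + s) \<in> S) \<longrightarrow>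
      \<bar>E ts\<bar> \<le> K * (dt_max ts)\<^sup>2"
    if S: "open S" "bounded_in_Ck 3 S (\<lambda>(x, t). u x t)" for S
  proof -
    obtain K where K: "\<forall>ts X l. discretization T ts \<and> 2 \<le> steps ts \<and> discrete_dual_path H g ts X l \<and>
      (\<forall>n\<le>steps ts. norm (l n - grad (\<lambda>x. u x (ts ! n)) (X n)) \<le> C * dt_max ts) \<and>
      (\<forall>n<steps ts. \<forall>s\<in>{0..dt ts n}. 0 < ts ! n + s \<and> ts ! n + s < T \<longrightarrow>
         (X n + s *\<^sub>R grad (H (X n)) (l (Suc n)), ts ! n + s) \<in> S) \<longrightarrow>
      \<bar>(\<Sum>n<steps ts. dt ts n * (H (X n) (l (Suc n)) - grad (H (X n)) (l (Suc n)) \<bullet> l (Suc n)))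
         + g (X (steps ts)) - u (X 0) 0 - (\<Sum>n<steps ts. (dt ts n)\<^sup>2 * error_density H X l n)\<bar>
      \<le> K * (dt_max ts)\<^sup>2"
      using discrete_value_error[OF HJB T_pos S iii_bounded] by blast
    have "\<bar>E ts\<bar> \<le> K * (dt_max ts)\<^sup>2" if ts: "discretization T ts" "2 \<le> steps ts"
      "\<forall>n<steps ts. \<forall>s\<in>{0..dt ts n}. 0 < ts ! n + s \<and> ts ! n + s < T \<longrightarrow>
         (X\<^sub>d ts n + s *\<^sub>R grad (H (X\<^sub>d ts n)) (l\<^sub>d ts (Suc n)), ts ! n + s) \<in> S" for ts
      using K[rule_format, of ts "X\<^sub>d ts" "l\<^sub>d ts"] ts dual[OF ts(1)] C[OF ts(1)]
      by (simp add: E_def start[OF ts(1)])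
    then show ?thesis by blast
  qed
  show ?thesis
  proof (intro conjI impI; (elim exE conjE)?)
    assume C3: "bounded_in_Ck 3 (UNIV \<times> {0<..<T}) (\<lambda>(x, t). u x t)"
    have "open (UNIV \<times> {0<..<T} :: ('a \<times> real) set)" by (intro open_Times) auto
    from error[OF this C3] obtain K where K: "\<And>ts. discretization T ts \<Longrightarrow> 2 \<le> steps ts \<Longrightarrow> \<bar>E ts\<bar> \<le> K * (dt_max ts)\<^sup>2"
      by auto
    \<comment> \<open>The second summand covers the single discretization [0,T], whose maximal step
      is T; this explains the division by T^2.\<close>
    define C' where "C' = \<bar>K\<bar> + \<bar>E [0, T]\<bar> / T\<^sup>2"
    have "\<bar>E ts\<bar> \<le> C' * (dt_max ts)\<^sup>2" if ts: "discretization T ts" for ts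
    proof (cases "2 \<le> steps ts")
      case True
      have "K \<le> C'" unfolding C'_def by (smt (verit) zero_le_divide_iff zero_le_power2)
      with K[OF ts True] show ?thesis by (meson mult_right_mono order_trans zero_le_power2)
    next
      case False
      from discretization_one_step[OF ts False] show ?thesis using T_pos by (simp add: C'_def field_simps)
    qed
    then show "\<exists>C'. \<forall>ts. discretization T ts \<longrightarrow>
               (\<exists>R. discrete_value H g ts 0 x\<^sub>0 - ereal (u x\<^sub>0 0) =
                      ereal ((\<Sum>n<steps ts. (dt ts n)\<^sup>2 * error_density H (X\<^sub>d ts) (l\<^sub>d ts) n) + R) \<and>
                    \<bar>R\<bar> \<le> C' * (dt_max ts)\<^sup>2)"
      using representation by blast
  next
    fix X \<epsilon>
    assume X: "is_minimizer T \<B> f h g x\<^sub>0 0 X" and \<epsilon>: "0 < \<epsilon>"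
      and C3: "bounded_in_Ck 3 {(x, t). 0 < t \<and> t < T \<and> norm (x - X t) < \<epsilon>} (\<lambda>(x, t). u x t)"
      and conv: "\<forall>e>0. \<exists>\<delta>>0. \<forall>ts. discretization T ts \<and> dt_max ts < \<delta> \<longrightarrow>
                  (MAX n\<in>{..steps ts}. norm (X\<^sub>d ts n - X (ts ! n))) < e"
    have uc: "uniformly_continuous_on {0..T} X"
      using X unfolding is_minimizer_def admissible_def by (blast intro: absolutely_continuous_on_imp_uniformly)
    then have op: "open {(x, t). 0 < t \<and> t < T \<and> norm (x - X t) < \<epsilon>}"
      by (intro open_tube uniformly_continuous_imp_continuous)
    obtain K where K: "\<And>ts. discretization T ts \<Longrightarrow> 2 \<le> steps ts \<Longrightarrow>
      (\<forall>n<steps ts. \<forall>s\<in>{0..dt ts n}. 0 < ts ! n + s \<and> ts ! n + s < T \<longrightarrow>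
         (X\<^sub>d ts n + s *\<^sub>R grad (H (X\<^sub>d ts n)) (l\<^sub>d ts (Suc n)), ts ! n + s)
           \<in> {(x, t). 0 < t \<and> t < T \<and> norm (x - X t) < \<epsilon>}) \<Longrightarrow>
      \<bar>E ts\<bar> \<le> K * (dt_max ts)\<^sup>2"
      using error[OF op C3] by blast
    obtain M where M: "M \<ge> 0" "\<And>x l. norm (grad (H x) l) \<le> M"
      using bounded_in_C2_taylor[OF iii_bounded] by metis
    obtain \<delta>\<^sub>1 where \<delta>1: "\<delta>\<^sub>1 > 0" "\<And>ts. discretization T ts \<Longrightarrow> dt_max ts < \<delta>\<^sub>1 \<Longrightarrow>
        (MAX n\<in>{..steps ts}. norm (X\<^sub>d ts n - X (ts ! n))) < \<epsilon> / 3"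
      using conv[rule_format, of "\<epsilon> / 3"] \<epsilon> by auto
    obtain \<delta>\<^sub>2 where \<delta>2: "\<delta>\<^sub>2 > 0" "\<And>s t. s \<in> {0..T} \<Longrightarrow> t \<in> {0..T} \<Longrightarrow> dist t s < \<delta>\<^sub>2 \<Longrightarrow> dist (X t) (X s) < \<epsilon> / 3"
      using uc[unfolded uniformly_continuous_on_def, rule_format, of "\<epsilon> / 3"] \<epsilon> by auto
    define \<tau> where "\<tau> = min (min (\<delta>\<^sub>1 / 2) (\<delta>\<^sub>2 / 2)) (min (\<epsilon> / (3 * (M + 1))) (T / 2))"
    have \<tau>: "\<tau> > 0" "\<tau> < \<delta>\<^sub>1" "\<tau> < \<delta>\<^sub>2" "\<tau> < T" "\<tau> \<le> \<epsilon> / (3 * (M + 1))"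
      using \<delta>1(1) \<delta>2(1) \<epsilon> M(1) T_pos by (auto simp: \<tau>_def)
    have "M * \<tau> \<le> (M + 1) * \<tau>" using \<tau>(1) by (simp add: algebra_simps)
    also have "\<dots> \<le> \<epsilon> / 3" using \<tau>(5) M(1) by (simp add: field_simps)
    finally have M\<tau>: "M * \<tau> \<le> \<epsilon> / 3" .
    have "\<bar>E ts\<bar> \<le> K * (dt_max ts)\<^sup>2" if ts: "discretization T ts" "dt_max ts \<le> \<tau>" for ts
    proof (rule K[OF ts(1)]; (intro allI impI ballI; elim conjE)?)
      show "2 \<le> steps ts"
      proof (rule ccontr)
        assume "\<not> 2 \<le> steps ts"
        with ts(1) have "dt_max ts = T" by (rule discretization_one_step)
        with ts(2) \<tau> show False by simp
      qed
      fix n s assume n: "n < steps ts" and s: "s \<in> {0..dt ts n}" "0 < ts ! n + s" "ts ! n + s < T"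
      let ?\<beta> = "grad (H (X\<^sub>d ts n)) (l\<^sub>d ts (Suc n))"
      have s\<tau>: "s \<le> \<tau>" using s discretization_nth(4)[OF ts(1) n] ts(2) by auto
      have "norm (X\<^sub>d ts n - X (ts ! n)) \<le> (MAX n\<in>{..steps ts}. norm (X\<^sub>d ts n - X (ts ! n)))"
        using n by (intro Max_ge) auto
      then have 1: "norm (X\<^sub>d ts n - X (ts ! n)) < \<epsilon> / 3"
        using \<delta>1(2)[OF ts(1)] ts(2) \<tau>(2) by linarith
      have "norm (s *\<^sub>R ?\<beta>) = s * norm ?\<beta>" using s by simp
      also have "\<dots> \<le> \<tau> * M" using s\<tau> s M by (intro mult_mono) auto
      finally have 2: "norm (s *\<^sub>R ?\<beta>) \<le> \<epsilon> / 3" using M\<tau> by (simp add: mult.commute)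
      have "dist (X (ts ! n)) (X (ts ! n + s)) < \<epsilon> / 3"
        using \<delta>2(2)[of "ts ! n + s" "ts ! n"] discretization_nth(5)[OF ts(1), of n] n s s\<tau> \<tau>(3)
        by (auto simp: dist_real_def)
      then have 3: "norm (X (ts ! n) - X (ts ! n + s)) < \<epsilon> / 3" by (simp add: dist_norm)
      \<comment> \<open>The path from the discrete point to the minimizer at the same time goes back
        to the node, across to the minimizer at the node time, and forward along the minimizer. Each
        piece costs at most \<epsilon>/3, two of them strictly less.\<close>
      have "X\<^sub>d ts n + s *\<^sub>R ?\<beta> - X (ts ! n + s) =
          (X\<^sub>d ts n - X (ts ! n)) + s *\<^sub>R ?\<beta> + (X (ts ! n) - X (ts ! n + s))" by simp
      also have "norm \<dots> < \<epsilon>"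
        using 1 2 3 norm_triangle_ineq[of "X\<^sub>d ts n - X (ts ! n)" "s *\<^sub>R ?\<beta>"]
          norm_triangle_ineq[of "X\<^sub>d ts n - X (ts ! n) + s *\<^sub>R ?\<beta>" "X (ts ! n) - X (ts ! n + s)"]
        by linarith
      finally show "(X\<^sub>d ts n + s *\<^sub>R ?\<beta>, ts ! n + s) \<in> {(x, t). 0 < t \<and> t < T \<and> norm (x - X t) < \<epsilon>}"
        using s by simp
    qed
    then show "\<exists>dt_thres>0. \<exists>C'. \<forall>ts. discretization T ts \<and> dt_max ts \<le> dt_thres \<longrightarrow>
               (\<exists>R. discrete_value H g ts 0 x\<^sub>0 - ereal (u x\<^sub>0 0) =
                      ereal ((\<Sum>n<steps ts. (dt ts n)\<^sup>2 * error_density H (X\<^sub>d ts) (l\<^sub>d ts) n) + R) \<and>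
                    \<bar>R\<bar> \<le> C' * (dt_max ts)\<^sup>2)"
      using \<tau>(1) representation by blast
  qed
qed

end
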